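(* Let $A=(A_{i,j})_{i,j\in\mathbb Z}$ be a complex matrix such that for every $i\in\mathbb Z$, $A_{i,j}=0$ for $j\ll0$. Let $\tilde\Gamma_i=\sum_{j\in\mathbb Z}A_{i,j}\Gamma_j$, where $\Gamma(u)=\sum_{j\in\mathbb Z}\Gamma_ju^{-j}=H(u)E^\perp(-u)$ acts on $\Lambda$, and for $\lambda\in\mathbb Z^l$ let $\tilde s_\lambda=\tilde\Gamma_{-\lambda_1}\cdots\tilde\Gamma_{-\lambda_l}(1)$. (a) For any $\lambda\in\mathbb Z^l$, $\tilde s_\lambda=\sum_{\alpha\in\mathbb Z^l}A_{-\lambda_1,-\alpha_1}\cdots A_{-\lambda_l,-\alpha_l}s_\alpha$, and, if $A$ is invertible, $s_\alpha=\sum_{\lambda\in\mathbb Z^l}(A^{-1})_{-\alpha_1,-\lambda_1}\cdots(A^{-1})_{-\alpha_l,-\lambda_l}\tilde s_\lambda$. (b) (Analogue of the Jacobi–Trudi formula) For any $\lambda\in\mathbb Z^l$, $$\tilde s_\lambda=\det\left[\tilde h_{\lambda_i;\,i-j}\right]_{i,j=1,\dots,l},\qquad \tilde h_{k;m}=\sum_{r\in\mathbb Z}A_{-k,-r}h_{r-m}.$$ If $A$ is invertible, then the $\tilde h_{k;m}$ are the coefficients of the expansion $\sum_{k\in\mathbb Z}\tilde h_{k;m}\,g_k(u)=u^mH(u)$, where $g_k(u)=\sum_{s\in\mathbb Z}(A^{-1})_{-s,-k}u^s$. (c) The symmetric polynomials $\{\tilde s_\lambda\}_{\lambda\in\mathbb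 Z^l}$ satisfy the stability property $\tilde s_\lambda(x_1,\dots,x_n,0)=\tilde s_\lambda(x_1,\dots,x_n)$. (d) Let $A$ be invertible. Then we have the equality of $\Lambda$-valued formal distributions $$\mathcal S(u_1,\dots,u_l)=\sum_{\lambda\in\mathbb Z^l}\tilde s_\lambda\,g_{\lambda_1}(u_1)\cdots g_{\lambda_l}(u_l).$$ (e) Assume that $A_{i,j}=0$ for all $i<0$, $j\ge0$, and that $A_{0,j}=\delta_{0,j}$. Let $\lambda\in\mathbb N^l$, let $n\ge l$, and set $\lambda_{l+1}=\dots=\lambda_n=0$. Then $\tilde s_\lambda\in\Lambda$ can be identified with the symmetric polynomial in $(x_1,\dots,x_n)$ $$\tilde s_\lambda(x_1,\dots,x_n)=\frac{\det[f_{\lambda_j}(x_i)\,x_i^{n-j}]}{\det[x_i^{n-j}]},$$ where $f_k(x)=\sum_{j=1}^{-M(-k)}A_{-k,-j}x^j$ ($k\in\mathbb N$) are complex-valued polynomials with zero constant coefficient, $f_0(x)=1$, and $M(i)=\max\{k\in\mathbb Z: A_{i,r}=0\text{ for all }r<k\}$ is the position of the first non-zero entry in the $i$-th row of $A$.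
   Context: $\mathbb N=\{1,2,\dots\}$. $\Lambda=\mathbb C[p_1,p_2,\dots]$ is the ring of symmetric functions in $x_1,x_2,\dots$; $h_k,e_k$ are the complete and elementary symmetric functions ($h_0=e_0=1$, zero for $k<0$); $f^\perp$ is the adjoint of multiplication by $f$ for the scalar product in which Schur functions are orthonormal ($p_n^\perp=n\,\partial/\partial p_n$). $H(u)=\sum_{k\ge0}h_ku^k$, $E^\perp(u)=\sum_{k\ge0}e_k^\perp u^{-k}$. For each $f\in\Lambda$, $\Gamma_k(f)=0$ for $k\gg0$, so $\tilde\Gamma_i$ is well defined. ($\Gamma(u)$ is the $t=0$ specialization of the Hall–Littlewood vertex operator $E(-tu)H(u)E^\perp(-u)$, where $E(u)=\sum_{k\ge 0} e_k u^k$.) For any $\alpha\in\mathbb Z^l$, $s_\alpha=\det[h_{\alpha_i-i+j}]_{1\le i,j\le l}$ (the Schur function when $\alpha$ is a partition). The generating function is $$\mathcal S(u_1,\dots,u_l)=\Gamma(u_1)\cdots\Gamma(u_l)(1)=\prod_{1\le i<j\le l}\Big(1-\frac{u_j}{u_i}\Big)\prod_{i=1}^lH(u_i)=\sum_{\alpha\in\mathbb Z^l}s_\alpha u_1^{\alpha_1}\cdots u_l^{\alpha_l}.$$ For $f\in\Lambda$, $f(x_1,\dots,x_n)$ denotes the result of setting $x_{n+1}=x_{n+2}=\dots=0$. The determinants in (e) are of size $n\times n$. $B=(B_{i,j})_{i,j\in\mathbb Z}$ is the (left) inverse of $A$, written $B=A^{-1}$, if $\sum_{k\in\mathbb Z}B_{i,k}A_{k,j}=\delta_{i,j}$;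 $A$ is invertible if it has such an inverse. *)

theory Defs
  imports
    Complex_Main
    "HOL-Library.Poly_Mapping"
    "HOL-Computational_Algebra.Polynomial"
    "HOL-Computational_Algebra.Fraction_Field"
    "HOL-Combinatorics.Permutations"
    "Jordan_Normal_Form.Determinant"
begin

section \<open>Infinite sums\<close>

text \<open>All sums over infinite index sets are algebraic: either only finitely many terms are
  nonzero, or (for families of polynomials) this holds for each coefficient separately. The
  second notion is needed to expand in terms of an inverse matrix: for
  \<open>A i j = (if j = i then 1 else if j = i - 1 then -1 else 0)\<close> and the left inverse
  \<open>B i k = (if k \<le> i then 1 else 0)\<close>, infinitely many terms of such an expansion are nonzero,
  but only finitely many of each degree.\<close>

definition has_finite_sum :: "('i \<Rightarrow> 'a::comm_monoid_add) \<Rightarrow> 'i set \<Rightarrow> 'a \<Rightarrow> bool" where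
  "has_finite_sum a I s \<longleftrightarrow>
     finite {i \<in> I. a i \<noteq> 0} \<and> (\<Sum>i \<in> {i \<in> I. a i \<noteq> 0}. a i) = s"

definition has_formal_sum ::
    "('i \<Rightarrow> ('m \<Rightarrow>\<^sub>0 'a::comm_monoid_add)) \<Rightarrow> 'i set \<Rightarrow> ('m \<Rightarrow>\<^sub>0 'a) \<Rightarrow> bool" where
  "has_formal_sum a I s \<longleftrightarrow>
     (\<forall>m. has_finite_sum (\<lambda>i. Poly_Mapping.lookup (a i) m) I (Poly_Mapping.lookup s m))"

section \<open>Polynomials and symmetric functions\<close>

text \<open>Complex polynomials in countably many variables. This type serves both as
  the ring of symmetric functions, \<open>\<Lambda> = \<complex>[p\<^sub>1, p\<^sub>2, \<dots>]\<close>, where the variable with index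
  \<open>k\<close> is the power sum \<open>p\<^sub>k\<^sub>+\<^sub>1\<close>, and as a polynomial ring in \<open>x\<^sub>1, x\<^sub>2, \<dots>\<close>, where the
  variable with index \<open>i\<close> is \<open>x\<^sub>i\<^sub>+\<^sub>1\<close>.\<close>

type_synonym mpoly = "(nat \<Rightarrow>\<^sub>0 nat) \<Rightarrow>\<^sub>0 complex"
type_synonym symfun = mpoly

definition const :: "complex \<Rightarrow> mpoly" where
  "const c = Poly_Mapping.single 0 c"

definition xvar :: "nat \<Rightarrow> mpoly" where
  "xvar i = Poly_Mapping.single (Poly_Mapping.single i 1) 1"

definition subst :: "(nat \<Rightarrow> mpoly) \<Rightarrow> mpoly \<Rightarrow> mpoly" where
  "subst \<sigma> f = (\<Sum>m \<in> Poly_Mapping.keys f. const (Poly_Mapping.lookup f m) *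
     (\<Prod>i \<in> Poly_Mapping.keys m. \<sigma> i ^ Poly_Mapping.lookup m i))"

definition symmetric_poly :: "nat \<Rightarrow> mpoly \<Rightarrow> bool" where
  "symmetric_poly n g \<longleftrightarrow>
     (\<forall>m \<in> Poly_Mapping.keys g. Poly_Mapping.keys m \<subseteq> {..<n}) \<and>
     (\<forall>\<pi>. \<pi> permutes {..<n} \<longrightarrow> subst (\<lambda>i. xvar (\<pi> i)) g = g)"

text \<open>\<open>f(x\<^sub>1, \<dots>, x\<^sub>n)\<close> for \<open>f \<in> \<Lambda>\<close>: setting \<open>x\<^sub>n\<^sub>+\<^sub>1 = x\<^sub>n\<^sub>+\<^sub>2 = \<dots> = 0\<close> turns each \<open>p\<^sub>k\<close> into
  \<open>x\<^sub>1\<^sup>k + \<dots> + x\<^sub>n\<^sup>k\<close>.\<close>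

definition in_vars :: "nat \<Rightarrow> symfun \<Rightarrow> mpoly" where
  "in_vars n f = subst (\<lambda>k. \<Sum>i<n. xvar i ^ Suc k) f"

definition complete_poly :: "nat \<Rightarrow> nat \<Rightarrow> mpoly" where
  "complete_poly k n =
     (\<Sum>m \<in> {m. Poly_Mapping.keys m \<subseteq> {..<n} \<and>
                (\<Sum>i \<in> Poly_Mapping.keys m. Poly_Mapping.lookup m i) = k}.
        Poly_Mapping.single m 1)"

definition elementary_poly :: "nat \<Rightarrow> nat \<Rightarrow> mpoly" where
  "elementary_poly k n = (\<Sum>S \<in> {S. S \<subseteq> {..<n} \<and> card S = k}. \<Prod>i\<in>S. xvar i)"

text \<open>An element of \<open>\<Lambda>\<close> is determined by its specializations to finitely many variables
  (the power sums are algebraically independent).\<close>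

definition hsym :: "int \<Rightarrow> symfun" where
  "hsym k = (if k < 0 then 0 else (THE f. \<forall>n. in_vars n f = complete_poly (nat k) n))"

definition esym :: "nat \<Rightarrow> symfun" where
  "esym k = (THE f. \<forall>n. in_vars n f = elementary_poly k n)"

definition int_vecs :: "nat \<Rightarrow> int list set" where
  "int_vecs l = {\<alpha>. length \<alpha> = l}"

text \<open>In all determinants the indices run from 0 instead of 1, which does not affect the
  differences of indices.\<close>

definition schur :: "int list \<Rightarrow> symfun" where
  "schur \<alpha> = det (mat (length \<alpha>) (length \<alpha>) (\<lambda>(i, j). hsym (\<alpha> ! i - int i + int j)))"

definition is_partition :: "int list \<Rightarrow> bool" where
  "is_partition \<alpha> \<longleftrightarrow> sorted_wrt (\<ge>) \<alpha> \<and> (\<forall>a \<in> set \<alpha>. a > 0)"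

definition bilinear_form :: "(symfun \<Rightarrow> symfun \<Rightarrow> complex) \<Rightarrow> bool" where
  "bilinear_form \<beta> \<longleftrightarrow>
     (\<forall>f g w. \<beta> (f + g) w = \<beta> f w + \<beta> g w \<and> \<beta> w (f + g) = \<beta> w f + \<beta> w g) \<and>
     (\<forall>c f w. \<beta> (const c * f) w = c * \<beta> f w \<and> \<beta> w (const c * f) = c * \<beta> w f)"

text \<open>The form is unique because the Schur functions \<open>s\<^sub>\<mu>\<close>, \<open>\<mu>\<close> a partition, are a basis of
  \<open>\<Lambda>\<close>.\<close>

definition scalar_product :: "symfun \<Rightarrow> symfun \<Rightarrow> complex" where
  "scalar_product = (THE \<beta>. bilinear_form \<beta> \<and>
     (\<forall>\<mu> \<nu>. is_partition \<mu> \<longrightarrow> is_partition \<nu> \<longrightarrow>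
        \<beta> (schur \<mu>) (schur \<nu>) = (if \<mu> = \<nu> then 1 else 0)))"

definition perp :: "symfun \<Rightarrow> symfun \<Rightarrow> symfun" where
  "perp f g = (THE k. \<forall>w. scalar_product k w = scalar_product g (f * w))"

section \<open>Vertex operators\<close>

text \<open>\<open>Gam j\<close> is the coefficient of \<open>u\<^sup>-\<^sup>j\<close> in
  \<open>(\<Sum>a\<ge>0. h\<^sub>a u\<^sup>a) (\<Sum>b\<ge>0. (-1)\<^sup>b e\<^sub>b\<^sup>\<bottom> u\<^sup>-\<^sup>b)\<close>; only the terms with \<open>a - b = -j\<close> contribute.\<close>

definition Gam :: "int \<Rightarrow> symfun \<Rightarrow> symfun" where
  "Gam j f = Sum_any (\<lambda>b::nat. (-1) ^ b * hsym (int b - j) * perp (esym b) f)"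

text \<open>The coefficient of \<open>u\<^sub>1\<^sup>\<alpha>\<^sup>1 \<cdots> u\<^sub>l\<^sup>\<alpha>\<^sup>l\<close> in \<open>\<S>(u\<^sub>1, \<dots>, u\<^sub>l) = \<Gamma>(u\<^sub>1) \<cdots> \<Gamma>(u\<^sub>l)(1)\<close>.\<close>

definition gen_fun :: "int list \<Rightarrow> symfun" where
  "gen_fun \<alpha> = foldr (\<lambda>a f. Gam (- a) f) \<alpha> 1"

definition Gam_tilde :: "(int \<Rightarrow> int \<Rightarrow> complex) \<Rightarrow> int \<Rightarrow> symfun \<Rightarrow> symfun" where
  "Gam_tilde A i f = Sum_any (\<lambda>j. const (A i j) * Gam j f)"

definition s_tilde :: "(int \<Rightarrow> int \<Rightarrow> complex) \<Rightarrow> int list \<Rightarrow> symfun" where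
  "s_tilde A \<mu> = foldr (\<lambda>k f. Gam_tilde A (- k) f) \<mu> 1"

definition left_inverse :: "(int \<Rightarrow> int \<Rightarrow> complex) \<Rightarrow> (int \<Rightarrow> int \<Rightarrow> complex) \<Rightarrow> bool" where
  "left_inverse B A \<longleftrightarrow>
     (\<forall>i j. has_finite_sum (\<lambda>k. B i k * A k j) UNIV (if i = j then 1 else 0))"

definition h_tilde :: "(int \<Rightarrow> int \<Rightarrow> complex) \<Rightarrow> int \<Rightarrow> int \<Rightarrow> symfun" where
  "h_tilde A k m = Sum_any (\<lambda>r. const (A (- k) (- r)) * hsym (r - m))"

text \<open>\<open>g_coeff B k s\<close> is the coefficient of \<open>u\<^sup>s\<close> in \<open>g\<^sub>k(u)\<close>, where \<open>B\<close> is an inverse of \<open>A\<close>.\<close>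

definition g_coeff :: "(int \<Rightarrow> int \<Rightarrow> complex) \<Rightarrow> int \<Rightarrow> int \<Rightarrow> complex" where
  "g_coeff B k s = B (- s) (- k)"

text \<open>The value on a zero row, where the maximum does not exist, is irrelevant: all the
  summands of \<open>f_poly\<close> are then zero.\<close>

definition first_pos :: "(int \<Rightarrow> int \<Rightarrow> complex) \<Rightarrow> int \<Rightarrow> int" where
  "first_pos A i = (GREATEST k. \<forall>r<k. A i r = 0)"

definition f_poly :: "(int \<Rightarrow> int \<Rightarrow> complex) \<Rightarrow> int \<Rightarrow> complex poly" where
  "f_poly A k = (if k = 0 then 1
     else (\<Sum>j \<in> {1 .. - first_pos A (- k)}. monom (A (- k) (- j)) (nat j)))"

definition poly_at :: "complex poly \<Rightarrow> mpoly \<Rightarrow> mpoly" where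
  "poly_at q x = poly (map_poly const q) x"

end

theory Submission
  imports Defs "Jordan_Normal_Form.Char_Poly" "HOL-Computational_Algebra.Formal_Power_Series"
begin

text \<open>The operators \<open>e\<^sub>b\<^sup>\<bottom>\<close> are the coefficients of the ring homomorphism that translates the power sums,
  \<open>p\<^sub>i \<mapsto> p\<^sub>i - (-t)\<^sup>i\<close>. It sends \<open>h\<^sub>k\<close> to \<open>h\<^sub>k + t h\<^sub>k\<^sub>-\<^sub>1\<close>, so it acts on a Jacobi--Trudi determinant by column
  operations, and \<open>e\<^sub>b\<^sup>\<bottom>\<close> of such a determinant is a minor of the determinant with one more row. Laplace
  expansion along the new row therefore shows that a vertex operator prepends a row. As only this
  behaviour of the rows under translation matters, the same computation gives \<open>\<Gamma>\<^sub>-\<^sub>a s\<^sub>\<alpha> = s\<^sub>(\<^sub>a\<^sub>,\<^sub>\<alpha>\<^sub>)\<close> and the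
  determinantal formula for the deformed Schur functions, whose rows are linear combinations of rows
  of complete symmetric functions.

  The scalar product is identified with the form in which the monomials in the power sums are
  orthogonal with squared norms \<open>z\<^sub>\<lambda>\<close>: the adjoints of the vertex operators for that form show that the
  Schur functions are orthonormal, and straightening together with induction on the degree shows
  that they span.\<close>

section \<open>Homomorphisms from polynomial rings\<close>

text \<open>The obstacle is that \<open>hsym\<close>, \<open>esym\<close>,
  \<open>scalar_product\<close> and \<open>perp\<close> are definite descriptions, so nothing can be
  computed before existence and uniqueness are settled. Explicit candidates \<open>qsym\<close> and
  \<open>hall\<close> therefore come first. Nondegeneracy of \<open>hall\<close> also yields the
  uniqueness of \<open>hsym\<close>: a function that vanishes in every finite number of variables is
  orthogonal to all products of complete functions. The inverse expansions have only a left inverse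
  at their disposal, and infinitely many terms may be nonzero. Homogeneity repairs this: a fixed
  coefficient sees only finitely many Schur functions of a given length, so sums can be exchanged
  coefficient by coefficient. In the bialternant formula the determinant of the coefficient matrix
  is never evaluated: it does not depend on \<lambda>, and \<lambda> = 0 identifies it with the
  Vandermonde determinant.\<close>

abbreviation keys where "keys \<equiv> Poly_Mapping.keys"
abbreviation lookup where "lookup \<equiv> Poly_Mapping.lookup"
abbreviation single where "single \<equiv> Poly_Mapping.single"

definition mono_eval :: "(nat \<Rightarrow> 'a::comm_monoid_mult) \<Rightarrow> (nat \<Rightarrow>\<^sub>0 nat) \<Rightarrow> 'a" where
  "mono_eval \<sigma> m = (\<Prod>i\<in>keys m. \<sigma> i ^ lookup m i)"

text \<open>The coefficient map is a parameter because the targets differ: \<open>subst\<close>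
  stays among polynomials, \<open>translate\<close> and \<open>pderivation\<close> pass to
  polynomials over them, and \<open>det_vandermonde_nonzero\<close> evaluates at complex
  numbers.\<close>

definition peval :: "(complex \<Rightarrow> 'a::comm_ring_1) \<Rightarrow> (nat \<Rightarrow> 'a) \<Rightarrow> mpoly \<Rightarrow> 'a" where
  "peval \<phi> \<sigma> f = (\<Sum>m\<in>keys f. \<phi> (lookup f m) * mono_eval \<sigma> m)"

lemma subst_eq_peval: "subst \<sigma> = peval const \<sigma>"
  by (simp add: fun_eq_iff subst_def peval_def mono_eval_def)

lemma poly_mapping_induct_add [case_names zero add]:
  fixes f :: "'a \<Rightarrow>\<^sub>0 'b::comm_monoid_add"
  assumes "P 0" and "\<And>m c f. P f \<Longrightarrow> P (single m c + f)"
  shows "P f"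
proof (induction f rule: Poly_Mapping.update_induct)
  case const
  show ?case using assms(1) by simp
next
  case (update f a b)
  have "Poly_Mapping.update a b f = single a b + f"
    using update(1) by (intro poly_mapping_eqI)
      (auto simp: lookup_update lookup_add lookup_single when_def in_keys_iff)
  then show ?case using assms(2) update by simp
qed

lemma mono_eval_superset:
  assumes "finite K" "keys m \<subseteq> K"
  shows "mono_eval \<sigma> m = (\<Prod>i\<in>K. \<sigma> i ^ lookup m i)"
  unfolding mono_eval_def
  by (rule prod.mono_neutral_left) (use assms in \<open>auto simp: in_keys_iff\<close>)

lemma mono_eval_0 [simp]: "mono_eval \<sigma> 0 = 1"
  by (simp add: mono_eval_def)

lemma mono_eval_single [simp]: "mono_eval \<sigma> (single i k) = \<sigma> i ^ k"
  by (simp add: mono_eval_superset[of "{i}"])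

lemma mono_eval_add: "mono_eval \<sigma> (m + n) = mono_eval \<sigma> m * mono_eval \<sigma> n"
proof -
  let ?K = "keys m \<union> keys n"
  have "keys (m + n) \<subseteq> ?K" by (rule Poly_Mapping.keys_add)
  then show ?thesis
    by (simp add: mono_eval_superset[of ?K] lookup_add power_add prod.distrib)
qed

lemma peval_superset:
  assumes "finite K" "keys f \<subseteq> K" "\<phi> 0 = 0"
  shows "peval \<phi> \<sigma> f = (\<Sum>m\<in>K. \<phi> (lookup f m) * mono_eval \<sigma> m)"
  unfolding peval_def
  by (rule sum.mono_neutral_left) (use assms in \<open>auto simp: in_keys_iff\<close>)

locale coeff_hom = comm_ring_hom hom for hom :: "complex \<Rightarrow> 'a::comm_ring_1"
begin

lemma peval_single [simp]: "peval hom \<sigma> (single m c) = hom c * mono_eval \<sigma> m"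
  by (simp add: peval_superset[of "{m}"])

lemma peval_add: "peval hom \<sigma> (f + g) = peval hom \<sigma> f + peval hom \<sigma> g"
proof -
  let ?K = "keys f \<union> keys g"
  have "keys (f + g) \<subseteq> ?K" by (rule Poly_Mapping.keys_add)
  then show ?thesis
    by (simp add: peval_superset[of ?K] lookup_add hom_add distrib_right sum.distrib)
qed

lemma peval_mult: "peval hom \<sigma> (f * g) = peval hom \<sigma> f * peval hom \<sigma> g"
proof (induction f rule: poly_mapping_induct_add)
  case zero
  show ?case by (simp add: peval_def)
next
  case (add m c f)
  have "peval hom \<sigma> (single m c * g) = hom c * mono_eval \<sigma> m * peval hom \<sigma> g"
  proof (induction g rule: poly_mapping_induct_add)
    case zero
    show ?case by (simp add: peval_def)
  next
    case (add n d g)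
    then show ?case
      by (simp add: distrib_left peval_add Poly_Mapping.mult_single hom_mult mono_eval_add mult_ac)
  qed
  then show ?case using add by (simp add: distrib_right peval_add)
qed

lemma comm_ring_hom_peval: "comm_ring_hom (peval hom \<sigma>)"
proof
  show "peval hom \<sigma> 0 = 0" by (simp add: peval_def)
  show "peval hom \<sigma> 1 = 1" using peval_single[of \<sigma> 0 1] by simp
qed (rule peval_add peval_mult)+

lemma peval_const [simp]: "peval hom \<sigma> (const c) = hom c"
  by (simp add: const_def)

lemma peval_xvar [simp]: "peval hom \<sigma> (xvar i) = \<sigma> i"
  by (simp add: xvar_def)

end

interpretation const: coeff_hom const
  by unfold_locales (simp_all add: const_def single_add Poly_Mapping.mult_single)

lemma mpoly_induct [case_names const add xvar]:
  assumes const: "\<And>c. P (const c)"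
    and add: "\<And>f g. P f \<Longrightarrow> P g \<Longrightarrow> P (f + g)"
    and xvar: "\<And>f i. P f \<Longrightarrow> P (xvar i * f)"
  shows "P f"
proof (induction f rule: poly_mapping_induct_add)
  case zero
  show ?case using const[of 0] by simp
next
  case (add m c f)
  have "P (single m c)"
  proof (induction m rule: poly_mapping_induct_add)
    case zero
    show ?case using const[of c] by (simp add: const_def)
  next
    case (add i k m)
    have *: "single (single i (Suc k) + m) c = xvar i * single (single i k + m) c" for k
    proof -
      have "single i (Suc k) = single i 1 + single i k" by (simp flip: single_add)
      then show ?thesis by (simp add: xvar_def Poly_Mapping.mult_single add.assoc)
    qed
    show ?case
    proof (induction k)
      case 0
      show ?case using add by simp
    next
      case (Suc k)
      then show ?case unfolding * by (rule xvar)
    qed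
  qed
  then show ?case using add assms(2) by blast
qed

lemma comm_ring_hom_eqI:
  assumes "comm_ring_hom F" "comm_ring_hom G"
    and "\<And>c. F (const c) = G (const c)" and "\<And>i. F (xvar i) = G (xvar i)"
  shows "F = G"
proof
  interpret F: comm_ring_hom F by fact
  interpret G: comm_ring_hom G by fact
  fix f show "F f = G f"
    by (induction f rule: mpoly_induct)
      (use assms(3,4) in \<open>simp_all add: F.hom_add G.hom_add F.hom_mult G.hom_mult\<close>)
qed

lemma comm_ring_hom_comp:
  assumes "comm_ring_hom F" "comm_ring_hom G"
  shows "comm_ring_hom (\<lambda>x. F (G x))"
proof -
  interpret F: comm_ring_hom F by fact
  interpret G: comm_ring_hom G by fact
  show ?thesis
    by unfold_locales (simp_all add: F.hom_add G.hom_add F.hom_mult G.hom_mult)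
qed

interpretation subst: comm_ring_hom "subst \<sigma>"
  unfolding subst_eq_peval by (rule const.comm_ring_hom_peval)

lemma subst_const [simp]: "subst \<sigma> (const c) = const c"
  and subst_xvar [simp]: "subst \<sigma> (xvar i) = \<sigma> i"
  by (simp_all add: subst_eq_peval)

lemma subst_subst: "subst \<sigma> (subst \<tau> f) = subst (\<lambda>i. subst \<sigma> (\<tau> i)) f"
proof -
  have "(\<lambda>f. subst \<sigma> (subst \<tau> f)) = subst (\<lambda>i. subst \<sigma> (\<tau> i))"
    by (rule comm_ring_hom_eqI)
      (auto intro: comm_ring_hom_comp subst.comm_ring_hom_axioms)
  then show ?thesis by metis
qed

interpretation in_vars: comm_ring_hom "in_vars n"
  unfolding in_vars_def[abs_def] by (rule subst.comm_ring_hom_axioms)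

lemma in_vars_const [simp]: "in_vars n (const c) = const c"
  and in_vars_xvar [simp]: "in_vars n (xvar k) = (\<Sum>i<n. xvar i ^ Suc k)"
  unfolding in_vars_def by simp_all

interpretation pconst: coeff_hom "\<lambda>c. [:const c:]"
  by unfold_locales (simp_all add: const.hom_add const.hom_mult one_pCons)

lemma const_eq_0_iff [simp]: "const c = 0 \<longleftrightarrow> c = 0"
  by (metis const_def lookup_single_eq single_zero lookup_zero)

lemma lookup_const_mult: "lookup (const c * f) m = c * lookup f m"
proof (induction f rule: poly_mapping_induct_add)
  case (add n d f)
  then show ?case
    by (auto simp: const_def distrib_left Poly_Mapping.mult_single lookup_add lookup_single when_def)
qed simp

text \<open>Subtraction of exponents is truncated, so exponent 0 at \<open>i\<close> is split off:
  there \<open>m - single i 1\<close> would be \<open>m\<close> itself.\<close>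

lemma lookup_xvar_mult:
  "lookup (xvar i * f) m = (if lookup m i = 0 then 0 else lookup f (m - single i 1))"
proof (induction f rule: poly_mapping_induct_add)
  case (add n c f)
  have *: "single i 1 + n = m \<longleftrightarrow> lookup m i \<noteq> 0 \<and> n = m - single i 1" for n :: "nat \<Rightarrow>\<^sub>0 nat"
    by (auto simp: poly_mapping_eq_iff fun_eq_iff lookup_add lookup_minus lookup_single when_def split: if_splits)
  have "lookup (xvar i * single n c) m = (if lookup m i = 0 then 0 else lookup (single n c) (m - single i 1))"
    by (simp add: xvar_def Poly_Mapping.mult_single lookup_single when_def) (use * in auto)
  with add show ?case
    by (simp add: distrib_left lookup_add)
qed simp

section \<open>Translation of the power sums\<close>

text \<open>Newton's recursion: \<open>qsym 1\<close> are the complete and \<open>qsym (-1)\<close> the elementary symmetric functions.\<close>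

fun qsym :: "complex \<Rightarrow> nat \<Rightarrow> symfun" where
  "qsym \<epsilon> 0 = 1"
| "qsym \<epsilon> (Suc n) = const (1 / of_nat (Suc n)) * (\<Sum>i\<le>n. const (\<epsilon> ^ i) * xvar i * qsym \<epsilon> (n - i))"

declare qsym.simps(2) [simp del]

lemma const_of_nat: "const (of_nat n) = of_nat n"
  by (simp add: const.hom_of_nat)

lemma qsym_newton:
  "of_nat (Suc n) * qsym \<epsilon> (Suc n) = (\<Sum>i\<le>n. const (\<epsilon> ^ i) * xvar i * qsym \<epsilon> (n - i))"
proof -
  have "of_nat (Suc n) * const (1 / of_nat (Suc n)) = 1"
    by (simp only: const_of_nat [symmetric] const.hom_mult [symmetric]) (simp add: field_simps del: of_nat_Suc)
  then show ?thesis
    by (simp only: qsym.simps(2) mult.assoc [symmetric]) simp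
qed

definition translate :: "complex \<Rightarrow> symfun \<Rightarrow> symfun poly" where
  "translate \<epsilon> = peval (\<lambda>c. [:const c:]) (\<lambda>i. [:xvar i:] + monom (const (\<epsilon> ^ i)) (Suc i))"

interpretation translate: comm_ring_hom "translate \<epsilon>"
  unfolding translate_def by (rule pconst.comm_ring_hom_peval)

lemma translate_const [simp]: "translate \<epsilon> (const c) = [:const c:]"
  and translate_xvar [simp]: "translate \<epsilon> (xvar i) = [:xvar i:] + monom (const (\<epsilon> ^ i)) (Suc i)"
  by (simp_all add: translate_def)

text \<open>The equation is a recursion for the coefficients; characteristic 0 without zero divisors
  allows \<open>of_nat (Suc m)\<close> to be cancelled. This stands in for the exponential of the
  series of p_k u^k / k.\<close>

lemma fps_ode_unique:
  fixes A B C :: "'a::{idom,ring_char_0} fps"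
  assumes A: "fps_deriv A = C * A" and B: "fps_deriv B = C * B" and "fps_nth A 0 = fps_nth B 0"
  shows "A = B"
proof -
  define D where "D = A - B"
  have D: "fps_deriv D = C * D" using A B by (simp add: D_def algebra_simps)
  have "fps_nth D n = 0" for n
  proof (induction n rule: less_induct)
    case (less n)
    show ?case
    proof (cases n)
      case 0
      then show ?thesis using assms(3) by (simp add: D_def)
    next
      case (Suc m)
      have "of_nat (Suc m) * fps_nth D (Suc m) = fps_nth (fps_deriv D) m" by simp
      also have "\<dots> = (\<Sum>i=0..m. fps_nth C i * fps_nth D (m - i))" by (simp add: D fps_mult_nth)
      also have "\<dots> = 0" using less Suc by (intro sum.neutral) auto
      finally show ?thesis using Suc by (simp del: of_nat_Suc)
    qed
  qed
  then have "D = 0" by (simp add: fps_eq_iff)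
  then show ?thesis by (simp add: D_def)
qed

text \<open>Newton's recursion says that the generating series Q satisfies Q' = P Q, with P the
  series of \<epsilon>^i p_(i+1) u^i. Under a homomorphism \<open>F\<close> this covers the original
  and the translated series alike.\<close>

lemma fps_deriv_qsym:
  fixes F :: "symfun \<Rightarrow> 'a::comm_ring_1"
  assumes "comm_ring_hom F"
  shows "fps_deriv (Abs_fps (\<lambda>n. F (qsym \<epsilon> n))) =
    Abs_fps (\<lambda>i. F (const (\<epsilon> ^ i) * xvar i)) * Abs_fps (\<lambda>n. F (qsym \<epsilon> n))"
proof (rule fps_ext)
  interpret F: comm_ring_hom F by fact
  fix n
  have "fps_nth (fps_deriv (Abs_fps (\<lambda>n. F (qsym \<epsilon> n)))) n = F (of_nat (Suc n) * qsym \<epsilon> (Suc n))"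
    by (simp only: F.hom_mult F.hom_of_nat) simp
  then show "fps_nth (fps_deriv (Abs_fps (\<lambda>n. F (qsym \<epsilon> n)))) n =
    fps_nth (Abs_fps (\<lambda>i. F (const (\<epsilon> ^ i) * xvar i)) * Abs_fps (\<lambda>n. F (qsym \<epsilon> n))) n"
    by (simp only: qsym_newton F.hom_sum F.hom_mult fps_mult_nth atMost_atLeast0 fps_nth_Abs_fps)
qed

text \<open>Translation adds to P the geometric series t / (1 - \<eta> t u); multiplying by 1 -
  \<eta> t u avoids the division.\<close>

lemma fps_translate_coeff:
  assumes "\<delta> * \<epsilon> = \<eta>"
  shows "(1 - fps_const [:0, const \<eta>:] * fps_X) * Abs_fps (\<lambda>i. translate \<epsilon> (const (\<delta> ^ i) * xvar i)) =
    (1 - fps_const [:0, const \<eta>:] * fps_X) * Abs_fps (\<lambda>i. [:const (\<delta> ^ i) * xvar i:]) + fps_const [:0, 1:]"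
proof -
  let ?U = "1 - fps_const [:0, const \<eta>:] * fps_X" and ?t = "fps_const [:0, 1:] :: symfun poly fps"
  let ?C = "Abs_fps (\<lambda>i. translate \<epsilon> (const (\<delta> ^ i) * xvar i))"
    and ?B = "Abs_fps (\<lambda>i. [:const (\<delta> ^ i) * xvar i:])"
  define G :: "symfun poly fps" where "G = Abs_fps (\<lambda>i. monom (const (\<eta> ^ i)) (Suc i))"
  have eta: "const (\<delta> ^ i) * const (\<epsilon> ^ i) = const (\<eta> ^ i)" for i
    using assms by (simp flip: const.hom_mult power_mult_distrib)
  have "translate \<epsilon> (const (\<delta> ^ i) * xvar i) = [:const (\<delta> ^ i) * xvar i:] + monom (const (\<eta> ^ i)) (Suc i)" for i
    unfolding translate.hom_mult translate_const translate_xvar eta [symmetric]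
    by (simp add: smult_add_right smult_monom)
  then have "?C = ?B + G"
    by (intro fps_ext) (simp add: G_def)
  moreover have "?U * G = ?t"
  proof (rule fps_ext)
    fix n
    show "fps_nth (?U * G) n = fps_nth ?t n"
    proof (cases n)
      case 0
      then show ?thesis by (simp add: G_def algebra_simps monom_Suc)
    next
      case (Suc m)
      have "[:0, const \<eta>:] = monom (const \<eta>) 1" by (simp add: monom_Suc monom_0)
      then have "[:0, const \<eta>:] * monom (const (\<eta> ^ m)) (Suc m) = monom (const (\<eta> ^ Suc m)) (Suc (Suc m))"
        by (simp only: mult_monom) (simp add: const.hom_mult)
      then show ?thesis using Suc
        by (simp add: G_def left_diff_distrib mult.assoc)
    qed
  qed
  ultimately show ?thesis by (simp add: distrib_left)
qed

text \<open>The translated series is Q(u) / (1 - t u): multiplied by 1 - t u it solves the same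
  equation as Q. For \<delta> = \<epsilon> = 1 this adjoins a variable to the complete
  functions.\<close>

lemma translate_qsym_same:
  assumes "\<delta> * \<epsilon> = 1"
  shows "translate \<epsilon> (qsym \<delta> (Suc n)) = pCons (qsym \<delta> (Suc n)) (translate \<epsilon> (qsym \<delta> n))"
proof -
  let ?U = "1 - fps_const [:0, const 1:] * fps_X"
  let ?A = "Abs_fps (\<lambda>n. translate \<epsilon> (qsym \<delta> n))" and ?Q = "Abs_fps (\<lambda>n. [:qsym \<delta> n:])"
  let ?C = "Abs_fps (\<lambda>i. translate \<epsilon> (const (\<delta> ^ i) * xvar i))"
    and ?B = "Abs_fps (\<lambda>i. [:const (\<delta> ^ i) * xvar i:])"
  have "?U * ?A = ?Q"
  proof (rule fps_ode_unique)
    have "fps_deriv (?U * ?A) = ?U * (?C * ?A) - fps_const [:0, 1:] * ?A"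
      by (simp add: fps_deriv_qsym translate.comm_ring_hom_axioms algebra_simps)
    also have "\<dots> = (?U * ?C - fps_const [:0, 1:]) * ?A" by (simp add: algebra_simps)
    also have "?U * ?C - fps_const [:0, 1:] = ?U * ?B" by (simp only: fps_translate_coeff[OF assms] add_diff_cancel)
    also have "?U * ?B * ?A = ?B * (?U * ?A)" by (simp only: mult_ac)
    finally show "fps_deriv (?U * ?A) = ?B * (?U * ?A)" .
    show "fps_deriv ?Q = ?B * ?Q"
      by (rule fps_deriv_qsym) (unfold_locales, auto simp: one_pCons)
    show "fps_nth (?U * ?A) 0 = fps_nth ?Q 0" by (simp add: one_pCons)
  qed
  then have "fps_nth (?U * ?A) (Suc n) = fps_nth ?Q (Suc n)" by simp
  then have "translate \<epsilon> (qsym \<delta> (Suc n)) - [:0, 1:] * translate \<epsilon> (qsym \<delta> n) = [:qsym \<delta> (Suc n):]"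
    by (simp add: left_diff_distrib mult.assoc)
  then have "translate \<epsilon> (qsym \<delta> (Suc n)) = [:qsym \<delta> (Suc n):] + [:0, 1:] * translate \<epsilon> (qsym \<delta> n)"
    by (simp only: diff_eq_eq)
  then show ?thesis by simp
qed

text \<open>Here the translated series is (1 + t u) Q(u), so t occurs only linearly. With \<delta> =
  1 this drives the column operations on Jacobi--Trudi matrices; with \<delta> = -1 it adjoins a
  variable to the elementary functions.\<close>

lemma translate_qsym_opposite:
  assumes "\<delta> * \<epsilon> = -1"
  shows "translate \<epsilon> (qsym \<delta> (Suc n)) = [:qsym \<delta> (Suc n), qsym \<delta> n:]"
proof -
  let ?U = "1 - fps_const [:0, const (-1):] * fps_X"
  let ?A = "Abs_fps (\<lambda>n. translate \<epsilon> (qsym \<delta> n))" and ?Q = "Abs_fps (\<lambda>n. [:qsym \<delta> n:])"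
  let ?C = "Abs_fps (\<lambda>i. translate \<epsilon> (const (\<delta> ^ i) * xvar i))"
    and ?B = "Abs_fps (\<lambda>i. [:const (\<delta> ^ i) * xvar i:])"
  have Q: "fps_deriv ?Q = ?B * ?Q"
    by (rule fps_deriv_qsym) (unfold_locales, auto simp: one_pCons)
  have t: "fps_const [:0, const (-1):] = - fps_const [:0, 1:]"
    by (simp add: const.hom_uminus)
  have "?A = ?U * ?Q"
  proof (rule fps_ode_unique)
    show "fps_deriv ?A = ?C * ?A"
      by (rule fps_deriv_qsym[OF translate.comm_ring_hom_axioms])
    define t' :: "symfun poly fps" where "t' = fps_const [:0, 1:]"
    have "fps_deriv t' = 0" by (simp add: t'_def)
    then have "fps_deriv (?U * ?Q) = (?U * ?B + fps_const [:0, 1:]) * ?Q"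
      unfolding t t'_def [symmetric] by (simp add: Q algebra_simps)
    also have "?U * ?B + fps_const [:0, 1:] = ?U * ?C" by (simp only: fps_translate_coeff[OF assms])
    also have "?U * ?C * ?Q = ?C * (?U * ?Q)" by (simp only: mult_ac)
    finally show "fps_deriv (?U * ?Q) = ?C * (?U * ?Q)" .
    show "fps_nth ?A 0 = fps_nth (?U * ?Q) 0" by (simp add: one_pCons)
  qed
  then have "fps_nth ?A (Suc n) = fps_nth (?U * ?Q) (Suc n)" by simp
  then show ?thesis unfolding t by (simp add: left_diff_distrib mult.assoc)
qed

lemma comm_ring_hom_id: "comm_ring_hom (\<lambda>x. x)"
  by unfold_locales auto

text \<open>This is E(-u) H(u) = 1: the two series solve equations with opposite coefficients, so
  their product has derivative 0 and equals its constant term.\<close>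

lemma sum_alternating_qsym:
  "(\<Sum>i\<le>n. const ((-1) ^ i) * qsym (-1) i * qsym 1 (n - i)) = (if n = 0 then 1 else 0)"
proof -
  let ?A = "Abs_fps (\<lambda>n. const ((-1) ^ n) * qsym (-1) n)" and ?H = "Abs_fps (\<lambda>n. qsym 1 n)"
    and ?E = "Abs_fps (\<lambda>n. qsym (-1) n)"
  let ?C = "Abs_fps xvar"
  have H: "fps_deriv ?H = ?C * ?H"
    using fps_deriv_qsym[of "\<lambda>x. x" 1] by (simp add: comm_ring_hom_id)
  have A: "fps_deriv ?A = - ?C * ?A"
  proof (rule fps_ext)
    fix n
    have "fps_nth (fps_deriv ?A) n = const ((-1) ^ Suc n) * (of_nat (Suc n) * qsym (-1) (Suc n))"
      by (simp add: algebra_simps)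
    also have "\<dots> = (\<Sum>i\<le>n. - xvar i * (const ((-1) ^ (n - i)) * qsym (-1) (n - i)))"
      unfolding qsym_newton sum_distrib_left
    proof (rule sum.cong)
      fix i assume "i \<in> {..n}"
      then have n: "n = i + (n - i)" by simp
      have "(-1) ^ n = (-1) ^ i * (-1 :: complex) ^ (n - i)"
        by (subst n) (rule power_add)
      then have "(-1) ^ Suc n * (-1) ^ i = - ((-1 :: complex) ^ (n - i))"
        by (simp flip: power_mult_distrib)
      then have "const ((-1) ^ Suc n) * const ((-1) ^ i) = - const ((-1) ^ (n - i))"
        by (simp only: const.hom_mult [symmetric] const.hom_uminus)
      then show "const ((-1) ^ Suc n) * (const ((-1) ^ i) * xvar i * qsym (-1) (n - i)) =
        - xvar i * (const ((-1) ^ (n - i)) * qsym (-1) (n - i))"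
        by (simp only: mult.assoc[symmetric]) (simp add: mult_ac)
    qed simp
    finally show "fps_nth (fps_deriv ?A) n = fps_nth (- ?C * ?A) n"
      by (simp add: fps_mult_nth atMost_atLeast0 sum_negf)
  qed
  have "fps_deriv (a * h) = 0" if "fps_deriv a = - c * a" "fps_deriv h = c * h" for a c h :: "symfun fps"
    using that by (simp add: algebra_simps)
  from this[OF A H] have "fps_deriv (?A * ?H) = fps_deriv 1" by (simp only: fps_deriv_1)
  then have "?A * ?H = 1"
    by (simp only: fps_deriv_eq_iff) simp
  then have "fps_nth (?A * ?H) n = fps_nth 1 n" by simp
  then show ?thesis by (simp add: fps_mult_nth atMost_atLeast0)
qed

text \<open>The complete functions generate the ring: Newton's recursion expresses p_(k+1) through
  (k+1) h_(k+1) and the products p_(i+1) h_(k-i) with i < k.\<close>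

lemma symfun_induct_qsym [case_names const add qsym]:
  assumes const: "\<And>c. P (const c)"
    and add: "\<And>f g. P f \<Longrightarrow> P g \<Longrightarrow> P (f + g)"
    and qsym: "\<And>f n. P f \<Longrightarrow> P (qsym 1 n * f)"
    and smult: "\<And>f c. P f \<Longrightarrow> P (const c * f)"
  shows "P f"
proof (induction f rule: mpoly_induct)
  case (xvar f k)
  have sum: "P (sum F I)" if "\<And>i. i \<in> I \<Longrightarrow> P (F i)" "finite I" for F and I :: "nat set"
    using that(2,1) const[of 0] by (induction I rule: finite_induct) (auto intro: add)
  have "P f \<Longrightarrow> P (xvar k * f)"
  \<comment> \<open>\<open>f\<close> stays arbitrary since the hypothesis is applied to
    \<open>qsym 1 (k - i) * f\<close>.\<close>
  proof (induction k arbitrary: f rule: less_induct)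
    case (less k)
    have "of_nat (Suc k) * qsym 1 (Suc k) = xvar k + (\<Sum>i<k. xvar i * qsym 1 (k - i))"
      unfolding qsym_newton by (simp add: lessThan_Suc_atMost[symmetric])
    then have "xvar k * f = of_nat (Suc k) * qsym 1 (Suc k) * f - (\<Sum>i<k. xvar i * qsym 1 (k - i)) * f"
      by (simp add: algebra_simps)
    also have "\<dots> = const (of_nat (Suc k)) * (qsym 1 (Suc k) * f) +
        const (-1) * (\<Sum>i<k. xvar i * (qsym 1 (k - i) * f))"
      by (simp only: const_of_nat) (simp add: sum_distrib_right mult.assoc const.hom_uminus)
    finally have *: "xvar k * f = \<dots>" .
    show ?case unfolding *
      by (intro add smult sum qsym less) auto
  qed
  then show ?case using xvar .
qed (use assms in blast)+

section \<open>The Hall form\<close>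

text \<open>\<open>pderivation k\<close> is \<open>(k + 1) \<partial>/\<partial>p\<^sub>k\<^sub>+\<^sub>1\<close>, read off from the linear coefficient of a translation so that the
  product rule is the multiplication of truncated polynomials.\<close>

definition pderivation :: "nat \<Rightarrow> symfun \<Rightarrow> symfun" where
  "pderivation k f = coeff (peval (\<lambda>c. [:const c:])
     (\<lambda>i. [:xvar i, if i = k then of_nat (Suc k) else 0:]) f) 1"

lemma pderivation_const [simp]: "pderivation k (const c) = 0"
  and pderivation_xvar: "pderivation k (xvar i) = (if i = k then of_nat (Suc k) else 0)"
  by (simp_all add: pderivation_def)

lemma pderivation_add: "pderivation k (f + g) = pderivation k f + pderivation k g"
  by (simp add: pderivation_def pconst.peval_add)

lemma pderivation_0 [simp]: "pderivation k 0 = 0"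
  using pderivation_const[of k 0] by simp

lemma pderivation_mult: "pderivation k (f * g) = pderivation k f * g + f * pderivation k g"
proof -
  let ?F = "peval (\<lambda>c. [:const c:]) (\<lambda>i. [:xvar i, if i = k then of_nat (Suc k) else 0:])"
  interpret F: comm_ring_hom ?F by (rule pconst.comm_ring_hom_peval)
  have 0: "coeff (?F h) 0 = h" for h
    by (induction h rule: mpoly_induct) (simp_all add: F.hom_add F.hom_mult)
  show ?thesis
    by (simp add: pderivation_def F.hom_mult coeff_mult 0 algebra_simps del: One_nat_def)
      (simp add: 0 coeff_mult)
qed

lemma pderivation_sum: "pderivation k (sum F I) = (\<Sum>i\<in>I. pderivation k (F i))"
  by (induction I rule: infinite_finite_induct) (simp_all add: pderivation_add)

lemma pderivation_1 [simp]: "pderivation k 1 = 0"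
  using pderivation_const[of k 1] by simp

lemma pderivation_of_nat [simp]: "pderivation k (of_nat n) = 0"
  using pderivation_const[of k "of_nat n"] by (simp add: const_of_nat)

text \<open>Differentiating Newton's recursion, the explicit p_(k+1) contributes a factor k + 1, and
  the remaining sum, reassembled by Newton's recursion at m - k, a factor m - k. Together they give
  m + 1, which cancels.\<close>

lemma pderivation_qsym:
  "pderivation k (qsym \<epsilon> n) = (if k < n then const (\<epsilon> ^ k) * qsym \<epsilon> (n - Suc k) else 0)"
proof (induction n rule: less_induct)
  case (less n)
  show ?case
  proof (cases n)
    case (Suc m)
    let ?e = "const (\<epsilon> ^ k)"
    have "of_nat (Suc m) * pderivation k (qsym \<epsilon> (Suc m)) = pderivation k (of_nat (Suc m) * qsym \<epsilon> (Suc m))"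
      by (simp only: pderivation_mult pderivation_of_nat) simp
    also have "\<dots> = (\<Sum>i\<le>m. (if i = k then ?e * of_nat (Suc k) * qsym \<epsilon> (m - k) else 0)) +
       (\<Sum>i\<le>m. const (\<epsilon> ^ i) * xvar i * pderivation k (qsym \<epsilon> (m - i)))"
      unfolding qsym_newton pderivation_sum sum.distrib [symmetric]
      by (intro sum.cong) (auto simp: pderivation_mult pderivation_xvar)
    also have "(\<Sum>i\<le>m. const (\<epsilon> ^ i) * xvar i * pderivation k (qsym \<epsilon> (m - i))) =
      (\<Sum>i\<le>m. const (\<epsilon> ^ i) * xvar i * (if k < m - i then ?e * qsym \<epsilon> (m - i - Suc k) else 0))"
      using less Suc by (intro sum.cong) auto
    also have "\<dots> = (\<Sum>i\<in>{i. i \<le> m \<and> k < m - i}. ?e * (const (\<epsilon> ^ i) * xvar i * qsym \<epsilon> (m - i - Suc k)))"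
      by (rule sum.mono_neutral_cong_right) auto
    also have "\<dots> = (if k \<le> m then ?e * of_nat (m - k) * qsym \<epsilon> (m - k) else 0)"
    proof (cases "m - k")
      case 0
      then have none: "{i. i \<le> m \<and> k < m - i} = {}" by auto
      show ?thesis unfolding none using 0 by simp
    next
      case (Suc d)
      then have "{i. i \<le> m \<and> k < m - i} = {..d}" by auto
      moreover have "m - i - Suc k = d - i" for i using Suc by simp
      ultimately have "(\<Sum>i\<in>{i. i \<le> m \<and> k < m - i}. ?e * (const (\<epsilon> ^ i) * xvar i * qsym \<epsilon> (m - i - Suc k))) =
        ?e * (of_nat (Suc d) * qsym \<epsilon> (Suc d))"
        by (simp only: sum_distrib_left [symmetric] qsym_newton)
      then show ?thesis using Suc by (simp add: mult.assoc)
    qed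
    finally have "of_nat (Suc m) * pderivation k (qsym \<epsilon> (Suc m)) =
      (if k \<le> m then ?e * (of_nat (Suc k) + of_nat (m - k)) * qsym \<epsilon> (m - k) else 0)"
      by (simp add: algebra_simps)
    also have "\<dots> = of_nat (Suc m) * (if k \<le> m then ?e * qsym \<epsilon> (m - k) else 0)"
      by (simp add: of_nat_diff algebra_simps)
    finally show ?thesis
      unfolding Suc by (simp only: mult_cancel_left of_nat_eq_0_iff) (simp add: less_Suc_eq_le)
  qed simp
qed

section \<open>The form on monomials in the power sums\<close>

definition zee :: "(nat \<Rightarrow>\<^sub>0 nat) \<Rightarrow> complex" where
  "zee m = (\<Prod>i\<in>keys m. of_nat (Suc i) ^ lookup m i * fact (lookup m i))"

text \<open>The variable with index i is p_(i+1), so exponents are multiplicities of parts and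
  \<open>zee m\<close> is the product of the k^(m_k) m_k!. The form is bilinear, without complex
  conjugation.\<close>

definition hall :: "symfun \<Rightarrow> symfun \<Rightarrow> complex" where
  "hall f g = (\<Sum>m\<in>keys f. lookup f m * lookup g m * zee m)"

lemma zee_nonzero [simp]: "zee m \<noteq> 0"
  by (simp add: zee_def del: of_nat_Suc)

lemma zee_superset:
  assumes "finite K" "keys m \<subseteq> K"
  shows "zee m = (\<Prod>i\<in>K. of_nat (Suc i) ^ lookup m i * fact (lookup m i))"
  unfolding zee_def by (rule prod.mono_neutral_left) (use assms in \<open>auto simp: in_keys_iff\<close>)

text \<open>The growth of the norm is exactly the factor in \<open>lookup_pderivation\<close>, which
  makes the derivation adjoint to multiplication by the power sum.\<close>

lemma zee_add_single: "zee (single k 1 + m) = of_nat (Suc k) * of_nat (Suc (lookup m k)) * zee m"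
proof -
  let ?K = "insert k (keys m)"
  have "keys (single k 1 + m) \<subseteq> ?K"
    using Poly_Mapping.keys_add[of "single k 1" m] by (auto split: if_splits)
  then have "zee (single k 1 + m) =
    (\<Prod>i\<in>?K. of_nat (Suc i) ^ lookup (single k 1 + m) i * fact (lookup (single k 1 + m) i))"
    by (intro zee_superset) auto
  also have "\<dots> = of_nat (Suc k) * of_nat (Suc (lookup m k)) *
    (of_nat (Suc k) ^ lookup m k * fact (lookup m k)) *
    (\<Prod>i\<in>?K - {k}. of_nat (Suc i) ^ lookup m i * fact (lookup m i))"
    by (subst prod.remove[of _ k])
      (auto simp: lookup_add lookup_single when_def algebra_simps simp del: of_nat_Suc intro!: prod.cong)
  also have "\<dots> = of_nat (Suc k) * of_nat (Suc (lookup m k)) * zee m"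
    by (subst zee_superset[of ?K m], simp, force, subst (2) prod.remove[of _ k]) (simp_all add: mult_ac)
  finally show ?thesis .
qed

lemma hall_superset:
  assumes "finite K" "keys f \<subseteq> K"
  shows "hall f g = (\<Sum>m\<in>K. lookup f m * lookup g m * zee m)"
  unfolding hall_def by (rule sum.mono_neutral_left) (use assms in \<open>auto simp: in_keys_iff\<close>)

lemma hall_commute: "hall f g = hall g f"
  by (simp add: hall_superset[of "keys f \<union> keys g"] mult_ac)

lemma hall_add_left: "hall (f + g) w = hall f w + hall g w"
proof -
  have "keys (f + g) \<subseteq> keys f \<union> keys g" by (rule Poly_Mapping.keys_add)
  then show ?thesis
    by (simp add: hall_superset[of "keys f \<union> keys g"] lookup_add algebra_simps sum.distrib)
qed

lemma hall_const_mult_left: "hall (const c * f) w = c * hall f w"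
proof -
  have "keys (const c * f) \<subseteq> keys f" by (auto simp: in_keys_iff lookup_const_mult)
  then show ?thesis
    by (simp add: hall_superset[of "keys f"] lookup_const_mult sum_distrib_left mult.assoc)
qed

lemma hall_add_right: "hall w (f + g) = hall w f + hall w g"
  by (metis hall_commute hall_add_left)

lemma hall_const_mult_right: "hall w (const c * f) = c * hall w f"
  by (metis hall_commute hall_const_mult_left)

lemma bilinear_form_hall: "bilinear_form hall"
  by (simp add: bilinear_form_def hall_add_left hall_add_right hall_const_mult_left hall_const_mult_right)

lemma hall_0 [simp]: "hall 0 w = 0" "hall w 0 = 0"
  by (simp_all add: hall_def)

lemma hall_single_right: "hall f (single m c) = lookup f m * c * zee m"
  unfolding hall_commute[of f] by (simp add: hall_superset[of "{m}"])

lemma hall_nondegenerate: "(\<And>w. hall f w = hall g w) \<Longrightarrow> f = g"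
  by (rule poly_mapping_eqI) (metis hall_single_right mult.right_neutral mult_right_cancel zee_nonzero)

lemma lookup_pderivation:
  "lookup (pderivation k f) m = of_nat (Suc k) * of_nat (Suc (lookup m k)) * lookup f (single k 1 + m)"
proof (induction f arbitrary: m rule: mpoly_induct)
  case (const c)
  have "lookup (single k 1 + m) k \<noteq> lookup 0 k" by (simp add: lookup_add)
  then have "single k 1 + m \<noteq> 0" by metis
  then have "lookup (const c) (single k 1 + m) = 0" by (simp add: const_def lookup_single when_def)
  then show ?case by simp
next
  case (add f g)
  then show ?case by (simp add: pderivation_add lookup_add algebra_simps)
next
  case (xvar f i)
  have *: "lookup (of_nat (Suc k) * g) m' = of_nat (Suc k) * lookup g m'" for g :: symfun and m'
    by (simp only: const_of_nat [symmetric] lookup_const_mult)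
  have "lookup (of_nat (Suc k) * f) m + lookup (xvar k * pderivation k f) m =
    of_nat (Suc k) * of_nat (Suc (lookup m k)) * lookup f m"
  proof (cases "lookup m k")
    case (Suc d)
    then have "single k 1 + (m - single k 1) = m"
      by (intro poly_mapping_eqI) (auto simp: lookup_add lookup_minus lookup_single when_def)
    then show ?thesis using Suc
      by (simp only: * lookup_xvar_mult xvar) (simp add: lookup_minus, simp add: algebra_simps)
  qed (simp only: * lookup_xvar_mult, simp)
  moreover have "single k 1 + m - single k 1 = m" by simp
  moreover have "single k 1 + m - single i 1 = single k 1 + (m - single i 1)" if "lookup m i \<noteq> 0"
    using that by (intro poly_mapping_eqI) (auto simp: lookup_add lookup_minus lookup_single when_def)
  ultimately show ?case
    by (cases "i = k") (auto simp: pderivation_mult pderivation_xvar lookup_add lookup_xvar_mult xvar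
        lookup_single lookup_minus when_def simp del: of_nat_Suc)
qed

lemma hall_pderivation: "hall (pderivation k f) g = hall f (xvar k * g)"
proof (induction g rule: poly_mapping_induct_add)
  case (add n c g)
  have "hall (pderivation k f) (single n c) = hall f (xvar k * single n c)"
    by (simp only: xvar_def Poly_Mapping.mult_single hall_single_right lookup_pderivation zee_add_single)
      (simp add: mult_ac)
  then show ?case using add by (simp add: distrib_left hall_add_right)
qed simp

text \<open>\<open>translate \<epsilon> f\<close> is the generating function of the adjoints of multiplication by \<open>qsym \<epsilon> j\<close>.
  The induction multiplies \<open>f\<close> by a power sum, whose own adjoint is a derivation.\<close>

lemma hall_coeff_translate: "hall (coeff (translate \<epsilon> f) j) g = hall f (qsym \<epsilon> j * g)"
proof (induction f arbitrary: g j rule: mpoly_induct)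
  case (const c)
  show ?case
  proof (cases j)
    case (Suc n)
    have "lookup (xvar i * w) 0 = 0" for i w by (simp add: lookup_xvar_mult)
    then have "lookup (qsym \<epsilon> j * g) 0 = 0"
      unfolding Suc qsym.simps(2) mult.assoc lookup_const_mult sum_distrib_right lookup_sum
      by (simp add: lookup_const_mult)
    then have "hall (const c) (qsym \<epsilon> j * g) = 0"
      by (subst hall_commute) (simp add: const_def hall_single_right)
    then show ?thesis using Suc by simp
  qed simp
next
  case (add f1 f2)
  then show ?case by (simp add: translate.hom_add hall_add_left)
next
  case (xvar f k)
  let ?T = "coeff (translate \<epsilon> f)"
  have "coeff (translate \<epsilon> (xvar k * f)) j =
    xvar k * ?T j + (if k < j then const (\<epsilon> ^ k) * ?T (j - Suc k) else 0)"
    by (auto simp: translate.hom_mult distrib_right coeff_monom_mult not_less)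
  then have "hall (coeff (translate \<epsilon> (xvar k * f)) j) g =
    hall (?T j) (pderivation k g) + (if k < j then \<epsilon> ^ k * hall (?T (j - Suc k)) g else 0)"
    using hall_pderivation[of k g "?T j"] hall_commute[of "xvar k * ?T j" g]
      hall_commute[of "?T j" "pderivation k g"]
    by (simp add: hall_add_left hall_const_mult_left)
  also have "\<dots> = hall f (qsym \<epsilon> j * pderivation k g +
      (if k < j then const (\<epsilon> ^ k) * (qsym \<epsilon> (j - Suc k) * g) else 0))"
    by (simp add: xvar hall_add_right hall_const_mult_right)
  also have "\<dots> = hall f (pderivation k (qsym \<epsilon> j * g))"
    by (simp add: pderivation_mult pderivation_qsym algebra_simps)
  also have "\<dots> = hall (xvar k * f) (qsym \<epsilon> j * g)"
    using hall_pderivation[of k "qsym \<epsilon> j * g" f] by (simp add: hall_commute)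
  finally show ?case .
qed

section \<open>Specialization to finitely many variables\<close>

definition vars_below :: "nat \<Rightarrow> mpoly \<Rightarrow> bool" where
  "vars_below n f \<longleftrightarrow> (\<forall>m\<in>keys f. keys m \<subseteq> {..<n})"

lemma vars_below_add: "vars_below n f \<Longrightarrow> vars_below n g \<Longrightarrow> vars_below n (f + g)"
  using Poly_Mapping.keys_add[of f g] unfolding vars_below_def by blast

lemma vars_below_mult:
  assumes "vars_below n f" "vars_below n g"
  shows "vars_below n (f * g)"
  unfolding vars_below_def
proof
  fix m assume "m \<in> keys (f * g)"
  then obtain a b where "m = a + b" "a \<in> keys f" "b \<in> keys g"
    using Poly_Mapping.keys_mult[of f g] by blast
  then show "keys m \<subseteq> {..<n}"
    using assms Poly_Mapping.keys_add[of a b] unfolding vars_below_def by blast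
qed

lemma vars_below_const [simp]: "vars_below n (const c)"
  by (simp add: vars_below_def const_def)

lemma vars_below_0 [simp]: "vars_below n 0" and vars_below_1 [simp]: "vars_below n 1"
  by (simp_all add: vars_below_def)

lemma vars_below_xvar: "i < n \<Longrightarrow> vars_below n (xvar i)"
  by (simp add: vars_below_def xvar_def)

lemma vars_below_power: "vars_below n f \<Longrightarrow> vars_below n (f ^ k)"
  by (induction k) (auto intro: vars_below_mult)

lemma vars_below_sum: "(\<And>i. i \<in> I \<Longrightarrow> vars_below n (F i)) \<Longrightarrow> vars_below n (sum F I)"
  by (induction I rule: infinite_finite_induct) (auto intro: vars_below_add)

lemma vars_below_in_vars: "vars_below n (in_vars n f)"
  by (induction f rule: mpoly_induct)
    (auto simp: in_vars.hom_add in_vars.hom_mult simp del: power_Suc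
      intro!: vars_below_add vars_below_mult vars_below_sum vars_below_power vars_below_xvar)

interpretation in_vars_poly: map_poly_comm_ring_hom "in_vars n" ..

text \<open>One further variable x_n adds x_n^k to p_k, which is translation with t = x_n.\<close>

lemma in_vars_Suc: "in_vars (Suc n) f = poly (map_poly (in_vars n) (translate 1 f)) (xvar n)"
proof -
  have "comm_ring_hom (\<lambda>f. poly (map_poly (in_vars n) (translate 1 f)) (xvar n))"
    by unfold_locales (simp_all add: translate.hom_add translate.hom_mult in_vars_poly.hom_add in_vars_poly.hom_mult)
  then have "in_vars (Suc n) = (\<lambda>f. poly (map_poly (in_vars n) (translate 1 f)) (xvar n))"
    by (intro comm_ring_hom_eqI in_vars.comm_ring_hom_axioms)
      (simp_all add: in_vars.map_poly_pCons_hom in_vars_poly.hom_add poly_monom del: power_Suc)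
  then show ?thesis by metis
qed

lemma lookup_xvar_power_mult:
  "lookup (xvar i ^ k * f) m = (if k \<le> lookup m i then lookup f (m - single i k) else 0)"
proof (induction k arbitrary: m)
  case (Suc k)
  have "m - single i 1 - single i k = m - single i (Suc k)"
    by (intro poly_mapping_eqI) (simp add: lookup_minus lookup_single when_def)
  then show ?case
    by (auto simp: mult.assoc lookup_xvar_mult Suc lookup_minus)
qed simp

text \<open>x_n is transcendental over the polynomials in the earlier variables.\<close>

lemma poly_xvar_eq_0_imp:
  assumes free: "\<And>j. vars_below n (coeff p j)" and "poly p (xvar n) = 0"
  shows "p = 0"
proof (rule poly_eqI)
  fix j
  show "coeff p j = coeff 0 j"
  proof (rule poly_mapping_eqI)
    fix m
    show "lookup (coeff p j) m = lookup (coeff 0 j) m"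
    proof (cases "lookup m n = 0")
      case False
      then have "n \<in> keys m" by (simp add: in_keys_iff)
      then have "m \<notin> keys (coeff p j)"
        using free[of j] unfolding vars_below_def by blast
      then show ?thesis by (simp add: in_keys_iff)
    next
      case True
      \<comment> \<open>For i < j a power of x_n would be left over, which \<open>coeff p i\<close>
        cannot contain; for i > j the monomial is not divisible by x_n^i. So only i = j
        contributes.\<close>
      have "lookup (coeff p i) (single n j + m - single n i) = 0" if "i < j" for i
      proof -
        have "lookup (single n j + m - single n i) n \<noteq> 0"
          using that True by (simp add: lookup_minus lookup_add)
        then have "n \<in> keys (single n j + m - single n i)" by (simp add: in_keys_iff)
        then have "single n j + m - single n i \<notin> keys (coeff p i)"
          using free[of i] unfolding vars_below_def by blast
        then show ?thesis by (simp add: in_keys_iff)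
      qed
      then have "lookup (xvar n ^ i * coeff p i) (single n j + m) = (if i = j then lookup (coeff p j) m else 0)" for i
        using True by (auto simp: lookup_xvar_power_mult lookup_add)
      then have "lookup (poly p (xvar n)) (single n j + m) = (\<Sum>i\<le>degree p. if i = j then lookup (coeff p j) m else 0)"
        by (simp add: poly_altdef lookup_sum mult.commute)
      also have "\<dots> = lookup (coeff p j) m"
        by (auto simp: coeff_eq_0)
      finally show ?thesis using assms(2) by simp
    qed
  qed
qed

text \<open>In n + 1 variables f becomes a polynomial in x_n with these coefficients. Hence the
  common kernel of all specializations is stable under the adjoints of multiplication by
  h_j.\<close>

lemma in_vars_coeff_translate_eq_0:
  assumes "\<And>n. in_vars n f = 0"
  shows "in_vars n (coeff (translate 1 f) j) = 0"
proof -
  have "map_poly (in_vars n) (translate 1 f) = 0"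
    by (rule poly_xvar_eq_0_imp[of n])
      (simp_all add: coeff_map_poly vars_below_in_vars assms flip: in_vars_Suc)
  then have "coeff (map_poly (in_vars n) (translate 1 f)) j = 0" by simp
  then show ?thesis by (simp add: coeff_map_poly)
qed

lemma in_vars_0: "in_vars 0 f = const (lookup f 0)"
  by (induction f rule: mpoly_induct)
    (simp_all add: in_vars.hom_add in_vars.hom_mult lookup_add lookup_xvar_mult const.hom_add, simp add: const_def)

text \<open>A function in the common kernel stays there under the adjoints of the h_j and has
  constant term 0, by the case of no variables. So it is orthogonal to every product of complete
  functions.\<close>

lemma in_vars_inject:
  assumes "\<And>n. in_vars n f = in_vars n g"
  shows "f = g"
proof -
  have "hall f w = 0" if "\<And>n. in_vars n f = 0" for f w
    using that
  proof (induction w arbitrary: f rule: symfun_induct_qsym)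
    case (const c)
    have "lookup f 0 = 0" using in_vars_0[of f] const[of 0] by simp
    then show ?case by (simp add: const_def hall_single_right)
  next
    case (qsym g n)
    have "hall (coeff (translate 1 f) n) g = 0"
      using in_vars_coeff_translate_eq_0[OF qsym(2)] by (intro qsym(1))
    then show ?case by (simp add: hall_coeff_translate)
  qed (simp_all add: hall_add_right hall_const_mult_right)
  from this[of "f - g"] have "f - g = 0"
    using assms by (intro hall_nondegenerate) (simp add: in_vars.hom_minus)
  then show ?thesis by simp
qed

lemma in_vars_0_qsym_Suc: "in_vars 0 (qsym \<epsilon> (Suc k)) = 0"
  by (simp add: qsym.simps(2) in_vars.hom_mult in_vars.hom_sum)

section \<open>Complete and elementary polynomials as specializations of \<open>qsym\<close>\<close>

definition tdeg :: "(nat \<Rightarrow>\<^sub>0 nat) \<Rightarrow> nat" where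
  "tdeg m = (\<Sum>i\<in>keys m. lookup m i)"

lemma tdeg_superset:
  assumes "finite K" "keys m \<subseteq> K"
  shows "tdeg m = (\<Sum>i\<in>K. lookup m i)"
  unfolding tdeg_def by (rule sum.mono_neutral_left) (use assms in \<open>auto simp: in_keys_iff\<close>)

lemma finite_monomials: "finite {m. keys m \<subseteq> {..<n} \<and> tdeg m = k}" (is "finite ?M")
proof (rule finite_imageD)
  show "inj_on lookup ?M" by (meson inj_onI poly_mapping_eq_iff)
  have "lookup m i \<le> tdeg m" if "keys m \<subseteq> {..<n}" "i < n" for m i
    using that by (simp add: tdeg_superset[of "{..<n}"] member_le_sum)
  then have "lookup ` ?M \<subseteq> {f. \<forall>i. (i \<in> {..<n} \<longrightarrow> f i \<in> {..k}) \<and> (i \<notin> {..<n} \<longrightarrow> f i = 0)}"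
    by (force simp: in_keys_iff)
  then show "finite (lookup ` ?M)"
    by (rule finite_subset) (rule finite_set_of_finite_funs, auto)
qed

lemma lookup_complete_poly:
  "lookup (complete_poly k n) m = (if keys m \<subseteq> {..<n} \<and> tdeg m = k then 1 else 0)"
  using finite_monomials[of n k]
  by (simp add: complete_poly_def tdeg_def lookup_sum lookup_single when_def)

lemma complete_poly_0: "complete_poly 0 n = 1"
proof (rule poly_mapping_eqI)
  fix m
  have "tdeg m = 0 \<longleftrightarrow> m = 0"
    by (auto simp: tdeg_def in_keys_iff intro: poly_mapping_eqI)
  then have "keys m \<subseteq> {..<n} \<and> tdeg m = 0 \<longleftrightarrow> m = 0"
    by auto
  then show "lookup (complete_poly 0 n) m = lookup 1 m"
    by (simp add: lookup_complete_poly lookup_one when_def)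
qed

lemma complete_poly_Suc_0: "complete_poly (Suc k) 0 = 0"
  by (intro poly_mapping_eqI) (auto simp: lookup_complete_poly tdeg_def)

lemma complete_poly_Suc_Suc:
  "complete_poly (Suc k) (Suc n) = complete_poly (Suc k) n + xvar n * complete_poly k (Suc n)"
proof (rule poly_mapping_eqI)
  fix m
  show "lookup (complete_poly (Suc k) (Suc n)) m =
    lookup (complete_poly (Suc k) n + xvar n * complete_poly k (Suc n)) m"
  proof (cases "lookup m n = 0")
    case True
    then have "n \<notin> keys m" by (simp add: in_keys_iff)
    then have "keys m \<subseteq> {..<Suc n} \<longleftrightarrow> keys m \<subseteq> {..<n}"
      by (auto simp: lessThan_Suc)
    then show ?thesis using True by (simp add: lookup_add lookup_complete_poly lookup_xvar_mult)
  next
    case False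
    define m' where "m' = m - single n 1"
    have m: "m = single n 1 + m'"
      using False unfolding m'_def
      by (intro poly_mapping_eqI) (auto simp: lookup_add lookup_minus lookup_single when_def)
    have keys: "keys m = insert n (keys m')"
      by (auto simp: m in_keys_iff lookup_add lookup_single when_def split: if_splits)
    have "tdeg m = Suc (tdeg m')" if "keys m \<subseteq> {..<Suc n}"
    proof -
      have "tdeg m = (\<Sum>i<Suc n. lookup (single n 1) i) + (\<Sum>i<Suc n. lookup m' i)"
        using that by (simp add: tdeg_superset[of "{..<Suc n}"] m lookup_add sum.distrib del: sum.lessThan_Suc)
      also have "(\<Sum>i<Suc n. lookup (single n 1) i) = (1::nat)"
        by (simp add: lookup_single when_def)
      also have "(\<Sum>i<Suc n. lookup m' i) = tdeg m'"
        using that keys by (intro tdeg_superset[symmetric]) auto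
      finally show ?thesis by simp
    qed
    moreover have "lookup (xvar n * complete_poly k (Suc n)) m = lookup (complete_poly k (Suc n)) m'"
      by (simp only: lookup_xvar_mult m'_def False if_False)
    moreover have "\<not> keys m \<subseteq> {..<n}" "keys m \<subseteq> {..<Suc n} \<longleftrightarrow> keys m' \<subseteq> {..<Suc n}"
      by (auto simp: keys)
    ultimately show ?thesis
      by (auto simp: lookup_add lookup_complete_poly)
  qed
qed

text \<open>\<open>in_vars_Suc\<close> turns \<open>translate_qsym_same\<close> into the recursion
  \<open>complete_poly_Suc_Suc\<close>. Its last term keeps n + 1 variables, hence the inner
  induction on k.\<close>

lemma in_vars_qsym_1: "in_vars n (qsym 1 k) = complete_poly k n"
proof (induction n arbitrary: k)
  case 0
  show ?case by (cases k) (simp_all add: complete_poly_0 complete_poly_Suc_0 in_vars_0_qsym_Suc)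
next
  case (Suc n)
  note IH = Suc
  show ?case
  proof (induction k)
    case 0
    show ?case by (simp add: complete_poly_0)
  next
    case (Suc k)
    then show ?case
      by (simp add: in_vars_Suc[of n "qsym 1 (Suc k)"] translate_qsym_same in_vars.map_poly_pCons_hom complete_poly_Suc_Suc IH
          flip: in_vars_Suc)
  qed
qed

lemma elementary_poly_0: "elementary_poly 0 n = 1"
proof -
  have "{S. S \<subseteq> {..<n} \<and> card S = 0} = {{}}" by (auto dest: finite_subset)
  then show ?thesis by (simp only: elementary_poly_def) simp
qed

lemma elementary_poly_Suc_0: "elementary_poly (Suc k) 0 = 0"
proof -
  have "{S. S \<subseteq> {..<0::nat} \<and> card S = Suc k} = {}" by auto
  then show ?thesis by (simp only: elementary_poly_def) simp
qed

lemma elementary_poly_Suc_Suc: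
  "elementary_poly (Suc k) (Suc n) = elementary_poly (Suc k) n + xvar n * elementary_poly k n"
proof -
  let ?U = "\<lambda>k n. {S. S \<subseteq> {..<n::nat} \<and> card S = k}"
  have fin: "finite S" if "S \<subseteq> {..<n}" for S :: "nat set"
    using that finite_subset by blast
  have "S \<in> ?U (Suc k) n \<union> insert n ` ?U k n" if S: "S \<in> ?U (Suc k) (Suc n)" for S
  proof (cases "n \<in> S")
    case True
    have "finite S" using S finite_subset[of S "{..<Suc n}"] by auto
    then have "card (S - {n}) = k" using S True by simp
    moreover have "S - {n} \<subseteq> {..<n}" using S by (auto simp: less_Suc_eq)
    ultimately show ?thesis using True by (intro UnI2 image_eqI[of _ _ "S - {n}"]) auto
  next
    case False
    then have "S \<subseteq> {..<n}" using S by (auto simp: less_Suc_eq)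
    then show ?thesis using S by auto
  qed
  moreover have "insert n S \<in> ?U (Suc k) (Suc n)" if "S \<in> ?U k n" for S
    using that fin[of S] by (auto simp: card_insert_if)
  moreover have "S \<in> ?U (Suc k) (Suc n)" if "S \<in> ?U (Suc k) n" for S
    using that by auto
  ultimately have U: "?U (Suc k) (Suc n) = ?U (Suc k) n \<union> insert n ` ?U k n" by blast
  have inj: "inj_on (insert n) (?U k n)"
    by (rule inj_onI) (auto dest!: insert_ident[THEN iffD1, rotated -1])
  have fins: "finite (?U j n)" for j by (rule finite_subset[of _ "Pow {..<n}"]) auto
  have "(\<Sum>S\<in>insert n ` ?U k n. prod xvar S) = (\<Sum>S\<in>?U k n. xvar n * prod xvar S)"
    unfolding sum.reindex[OF inj] o_def
    by (rule sum.cong) (auto simp: fin prod.insert_if)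
  then show ?thesis
    unfolding elementary_poly_def U sum_distrib_left
    by (subst sum.union_disjoint) (use fins in auto)
qed

lemma in_vars_qsym_minus_1: "in_vars n (qsym (-1) k) = elementary_poly k n"
proof (induction n arbitrary: k)
  case 0
  show ?case by (cases k) (simp_all add: elementary_poly_0 elementary_poly_Suc_0 in_vars_0_qsym_Suc)
next
  case (Suc n)
  show ?case
    by (cases k) (simp_all add: elementary_poly_0 in_vars_Suc translate_qsym_opposite in_vars.map_poly_pCons_hom
        elementary_poly_Suc_Suc Suc)
qed

lemma hsym_eq: "hsym k = (if k < 0 then 0 else qsym 1 (nat k))"
proof -
  have "(THE f. \<forall>n. in_vars n f = complete_poly (nat k) n) = qsym 1 (nat k)"
    by (rule the_equality) (auto simp: in_vars_qsym_1 intro!: in_vars_inject[of _ "qsym 1 (nat k)"])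
  then show ?thesis by (simp add: hsym_def)
qed

lemma esym_eq: "esym k = qsym (-1) k"
  unfolding esym_def
  by (rule the_equality) (auto simp: in_vars_qsym_minus_1 intro!: in_vars_inject[of _ "qsym (-1) k"])

section \<open>Determinants of Jacobi--Trudi type\<close>

text \<open>A row \<open>\<rho>\<close> of a Jacobi--Trudi type matrix is given as a function of the integer offset \<open>j - i\<close>
  from the diagonal. The identities below need only the compatibility condition \<open>jt_row\<close>, so that
  they apply to the rows of complete symmetric functions \<open>h\<close> and of the deformed \<open>h_tilde\<close> alike.\<close>

definition jt_mat :: "(int \<Rightarrow> 'a) list \<Rightarrow> 'a mat" where
  "jt_mat \<rho>s = mat (length \<rho>s) (length \<rho>s) (\<lambda>(i, j). (\<rho>s ! i) (int j - int i))"

definition jt :: "(int \<Rightarrow> 'a::comm_ring_1) list \<Rightarrow> 'a" where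
  "jt \<rho>s = det (jt_mat \<rho>s)"

definition jt_row :: "(int \<Rightarrow> symfun) \<Rightarrow> bool" where
  "jt_row \<rho> \<longleftrightarrow> (\<forall>k. translate (-1) (\<rho> k) = [:\<rho> k, \<rho> (k - 1):])"

lemma jt_Nil [simp]: "jt [] = 1"
  unfolding jt_def by (rule det_dim_zero) (simp add: jt_mat_def)

text \<open>Each column receives c times the original preceding column, all at once, which is right
  multiplication by a unitriangular matrix.\<close>

lemma mat_mult_upper_bidiagonal:
  fixes N :: "'a::comm_ring_1 mat" and c :: 'a
  assumes N: "N \<in> carrier_mat n n"
  defines "N' \<equiv> mat n n (\<lambda>(i, j). N $$ (i, j) + (if j = 0 then 0 else c * N $$ (i, j - 1)))"
  shows "det N' = det N"
proof -
  define U where "U = mat n n (\<lambda>(k, j). if k = j then 1 else if Suc k = j then c else (0::'a))"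
  have U: "U \<in> carrier_mat n n" by (simp add: U_def)
  have "N * U = N'"
  proof (rule eq_matI)
    fix i j assume "i < dim_row N'" "j < dim_col N'"
    then have ij: "i < n" "j < n" by (auto simp: N'_def)
    have "(N * U) $$ (i, j) = (\<Sum>k<n. N $$ (i, k) * (if k = j then 1 else if Suc k = j then c else 0))"
      using ij N U by (simp add: scalar_prod_def U_def lessThan_atLeast0)
    also have "\<dots> = (\<Sum>k<n. (if k = j then N $$ (i, k) else 0) + (if Suc k = j then c * N $$ (i, k) else 0))"
      by (rule sum.cong) (auto simp: mult.commute)
    also have "\<dots> = N $$ (i, j) + (\<Sum>k<n. if Suc k = j then c * N $$ (i, k) else 0)"
      using ij by (simp add: sum.distrib)
    also have "(\<Sum>k<n. if Suc k = j then c * N $$ (i, k) else 0) = (if j = 0 then 0 else c * N $$ (i, j - 1))"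
      using ij by (cases j) (auto simp: sum.delta')
    finally show "(N * U) $$ (i, j) = N' $$ (i, j)" using ij by (simp add: N'_def)
  qed (use N U in \<open>auto simp: N'_def\<close>)
  then have "det N' = det N * det U" using det_mult[OF N U] by simp
  moreover have "det U = 1"
  proof -
    have "upper_triangular U" unfolding upper_triangular_def by (auto simp: U_def)
    then have "det U = prod_list (diag_mat U)" using U by (rule det_upper_triangular)
    also have "diag_mat U = replicate n 1"
      by (auto simp: diag_mat_def U_def intro!: nth_equalityI)
    finally show ?thesis by simp
  qed
  ultimately show ?thesis by simp
qed

text \<open>Bordering the matrix of \<open>jt \<rho>s\<close> by the row \<open>1, -t, t\<^sup>2, \<dots>\<close>: adding \<open>t\<close> times each column to the
  next one turns the border into a unit vector and the remaining block into the translated matrix.\<close>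

lemma coeff_translate_jt:
  assumes rows: "\<And>\<rho>. \<rho> \<in> set \<rho>s \<Longrightarrow> jt_row \<rho>"
  shows "coeff (translate (-1) (jt \<rho>s)) b =
    (if b \<le> length \<rho>s then det (mat_delete (jt_mat (\<rho> # \<rho>s)) 0 b) else 0)"
proof -
  define l where "l = length \<rho>s"
  define M where "M = jt_mat (\<rho> # \<rho>s)"
  define N where "N = mat (Suc l) (Suc l) (\<lambda>(i, j). if i = 0 then monom ((-1) ^ j) j else [:M $$ (i, j):])"
  define N' where "N' = mat (Suc l) (Suc l) (\<lambda>(i, j). N $$ (i, j) + (if j = 0 then 0 else [:0, 1:] * N $$ (i, j - 1)))"
  have M: "M \<in> carrier_mat (Suc l) (Suc l)" by (simp add: M_def l_def jt_mat_def)
  have N: "N \<in> carrier_mat (Suc l) (Suc l)" and N': "N' \<in> carrier_mat (Suc l) (Suc l)"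
    by (simp_all add: N_def N'_def)
  have M_Suc: "M $$ (Suc i, j) = (\<rho>s ! i) (int j - int i - 1)" if "i < l" "j \<le> l" for i j
    using that by (simp add: M_def jt_mat_def l_def algebra_simps)
  have row0: "N' $$ (0, j) = (if j = 0 then 1 else 0)" if "j \<le> l" for j
  proof (cases j)
    case (Suc k)
    have "[:0, 1:] * monom ((-1) ^ k) k = (monom ((-1) ^ k) (Suc k) :: symfun poly)"
      by (simp add: monom_Suc)
    then show ?thesis using that Suc by (simp add: N'_def N_def add_monom)
  qed (use that in \<open>simp add: N'_def N_def\<close>)
  have "mat_delete N' 0 0 = map_mat (translate (-1)) (jt_mat \<rho>s)"
  proof (rule eq_matI)
    fix i j assume "i < dim_row (map_mat (translate (-1)) (jt_mat \<rho>s))"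
      "j < dim_col (map_mat (translate (-1)) (jt_mat \<rho>s))"
    then have ij: "i < l" "j < l" by (auto simp: jt_mat_def l_def)
    have "jt_row (\<rho>s ! i)" using ij rows by (simp add: l_def)
    then have "translate (-1) ((\<rho>s ! i) (int j - int i)) = [:(\<rho>s ! i) (int j - int i), (\<rho>s ! i) (int j - int i - 1):]"
      by (simp add: jt_row_def)
    then show "mat_delete N' 0 0 $$ (i, j) = map_mat (translate (-1)) (jt_mat \<rho>s) $$ (i, j)"
      using ij by (simp add: mat_delete_def N'_def N_def M_Suc) (simp add: jt_mat_def l_def)
  qed (simp_all add: mat_delete_def N'_def jt_mat_def l_def)
  then have "translate (-1) (jt \<rho>s) = det (mat_delete N' 0 0)"
    by (simp add: jt_def)
  also have "\<dots> = cofactor N' 0 0" by (simp add: cofactor_def)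
  also have "\<dots> = (\<Sum>j<Suc l. if j = 0 then cofactor N' 0 0 else 0)" by simp
  also have "\<dots> = (\<Sum>j<Suc l. N' $$ (0, j) * cofactor N' 0 j)"
    by (rule sum.cong) (auto simp: row0)
  also have "\<dots> = det N'" by (rule laplace_expansion_row[OF N', symmetric]) simp
  also have "\<dots> = det N" unfolding N'_def by (rule mat_mult_upper_bidiagonal[OF N])
  \<comment> \<open>In this second expansion the signs of the border cancel those of the cofactors,
    so t^j carries the plain minor.\<close>
  also have "\<dots> = (\<Sum>j<Suc l. N $$ (0, j) * cofactor N 0 j)" by (rule laplace_expansion_row[OF N]) simp
  also have "\<dots> = (\<Sum>j<Suc l. monom (det (mat_delete M 0 j)) j)"
  proof (rule sum.cong)
    interpret C: comm_ring_hom "\<lambda>x::symfun. [:x:]"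
      by unfold_locales (simp_all add: one_pCons)
    fix j assume j: "j \<in> {..<Suc l}"
    have "mat_delete N 0 j = map_mat (\<lambda>x. [:x:]) (mat_delete M 0 j)"
      using M by (intro eq_matI) (auto simp: mat_delete_def N_def)
    then have "det (mat_delete N 0 j) = [:det (mat_delete M 0 j):]" by (simp only: C.hom_det)
    then have "N $$ (0, j) * cofactor N 0 j = monom ((-1) ^ j) j * ((-1) ^ j * [:det (mat_delete M 0 j):])"
      using j by (simp add: cofactor_def N_def)
    also have "(-1) ^ j * [:det (mat_delete M 0 j):] = [:(-1) ^ j * det (mat_delete M 0 j):]"
      by (cases "even j") auto
    also have "monom ((-1) ^ j) j * \<dots> = monom (((-1) ^ j * (-1) ^ j) * det (mat_delete M 0 j)) j"
      by (simp add: smult_monom mult_ac)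
    also have "(-1) ^ j * (-1) ^ j = (1::symfun)" by (simp flip: power_mult_distrib)
    finally show "N $$ (0, j) * cofactor N 0 j = monom (det (mat_delete M 0 j)) j" by simp
  qed simp
  finally show ?thesis
    by (simp add: coeff_sum if_distrib sum.delta M_def l_def less_Suc_eq_le del: sum.lessThan_Suc)
qed

text \<open>The coefficient of the vertex operator \<open>(\<Sum>\<^sub>k \<rho>(k) u\<^sup>k) E\<^sup>\<bottom>(-u)\<close> that has \<open>\<rho> 0\<close> as its term without \<open>e\<^sub>b\<^sup>\<bottom>\<close>.\<close>

definition vertex :: "(int \<Rightarrow> symfun) \<Rightarrow> symfun \<Rightarrow> symfun" where
  "vertex \<rho> f = (\<Sum>b\<le>degree (translate (-1) f). (-1) ^ b * \<rho> (int b) * coeff (translate (-1) f) b)"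

lemma vertex_superset:
  assumes "finite K" "\<And>b. b \<notin> K \<Longrightarrow> coeff (translate (-1) f) b = 0"
  shows "vertex \<rho> f = (\<Sum>b\<in>K. (-1) ^ b * \<rho> (int b) * coeff (translate (-1) f) b)"
proof -
  have *: "(\<Sum>b\<in>K. (-1) ^ b * \<rho> (int b) * coeff (translate (-1) f) b) =
    (\<Sum>b\<in>{b. coeff (translate (-1) f) b \<noteq> 0}. (-1) ^ b * \<rho> (int b) * coeff (translate (-1) f) b)"
    if "finite K" "\<And>b. b \<notin> K \<Longrightarrow> coeff (translate (-1) f) b = 0" for K
    using that by (intro sum.mono_neutral_right) auto
  show ?thesis unfolding vertex_def using assms
    by (subst (1 2) *) (auto simp: not_le intro: coeff_eq_0)
qed

lemma vertex_jt:
  assumes rows: "\<And>\<rho>. \<rho> \<in> set \<rho>s \<Longrightarrow> jt_row \<rho>"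
  shows "vertex \<rho> (jt \<rho>s) = jt (\<rho> # \<rho>s)"
proof -
  have "vertex \<rho> (jt \<rho>s) = (\<Sum>b<Suc (length \<rho>s). (-1) ^ b * \<rho> (int b) * det (mat_delete (jt_mat (\<rho> # \<rho>s)) 0 b))"
    by (subst vertex_superset[of "{..<Suc (length \<rho>s)}"])
      (auto simp: coeff_translate_jt[OF rows, where \<rho> = \<rho>] simp del: sum.lessThan_Suc)
  also have "\<dots> = (\<Sum>b<Suc (length \<rho>s). jt_mat (\<rho> # \<rho>s) $$ (0, b) * cofactor (jt_mat (\<rho> # \<rho>s)) 0 b)"
    by (rule sum.cong) (auto simp: cofactor_def jt_mat_def mult_ac)
  also have "\<dots> = det (jt_mat (\<rho> # \<rho>s))"
    by (rule laplace_expansion_row[symmetric]) (simp_all add: jt_mat_def)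
  finally show ?thesis by (simp add: jt_def)
qed

lemma hsym_neg [simp]: "k < 0 \<Longrightarrow> hsym k = 0"
  by (simp add: hsym_eq)

lemma hsym_of_nat [simp]: "hsym (int n) = qsym 1 n"
  by (simp add: hsym_eq)

lemma hsym_0 [simp]: "hsym 0 = 1"
  by (simp add: hsym_eq)

lemma translate_hsym: "translate (-1) (hsym k) = [:hsym k, hsym (k - 1):]"
proof (cases "k > 0")
  case True
  then obtain n where "k = int (Suc n)" by (metis gr0_implies_Suc zero_less_imp_eq_int)
  then show ?thesis
    using translate_qsym_opposite[of 1 "-1" n] hsym_of_nat[of "Suc n"] by simp
qed (cases "k = 0"; simp add: one_pCons)

lemma jt_row_hsym: "jt_row (\<lambda>k. hsym (a + k))"
  by (auto simp: jt_row_def translate_hsym algebra_simps)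

lemma schur_eq_jt: "schur \<alpha> = jt (map (\<lambda>a k. hsym (a + k)) \<alpha>)"
  by (auto simp: schur_def jt_def jt_mat_def algebra_simps intro!: arg_cong[of _ _ det])

lemma schur_Nil [simp]: "schur [] = 1"
  by (simp add: schur_eq_jt)

lemma vertex_schur: "vertex (\<lambda>k. hsym (a + k)) (schur \<alpha>) = schur (a # \<alpha>)"
  unfolding schur_eq_jt by (subst vertex_jt) (auto simp: jt_row_hsym)

section \<open>Adjoints of the complete functions on Schur functions\<close>

lemma coeff_translate_1_hsym: "coeff (translate 1 (hsym k)) j = hsym (k - int j)"
proof (cases "k < 0")
  case False
  then obtain n where k: "k = int n" by (metis nat_0_le not_less)
  show ?thesis unfolding k
  proof (induction n arbitrary: j)
    case 0
    show ?case by (cases j) (simp_all del: hsym_of_nat)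
  next
    case (Suc n)
    have "coeff (translate 1 (hsym (int (Suc n)))) j =
      (case j of 0 \<Rightarrow> hsym (int (Suc n)) | Suc i \<Rightarrow> coeff (translate 1 (hsym (int n))) i)"
      by (simp only: hsym_of_nat) (simp add: translate_qsym_same coeff_pCons)
    then show ?case by (simp only: Suc) (cases j; simp del: hsym_of_nat add: algebra_simps)
  qed
qed simp

text \<open>Subtracting t times the neighbouring entry removes the tail of the geometric
  series.\<close>

lemma translate_1_hsym_diff: "translate 1 (hsym k) + - [:0, 1:] * translate 1 (hsym (k - 1)) = [:hsym k:]"
  by (rule poly_eqI) (simp add: coeff_translate_1_hsym coeff_pCons diff_diff_eq split: nat.split)

text \<open>Subtracting t times each column from the next leaves t only in the first column.
  Expansion along it involves cofactors of the untranslated matrix.\<close>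

lemma coeff_translate_1_schur:
  assumes "\<alpha> \<noteq> []"
  shows "coeff (translate 1 (schur \<alpha>)) k =
    (\<Sum>i<length \<alpha>. hsym (\<alpha> ! i - int i - int k) * cofactor (jt_mat (map (\<lambda>a k. hsym (a + k)) \<alpha>)) i 0)"
proof -
  define l where "l = length \<alpha>"
  define M where "M = jt_mat (map (\<lambda>a k. hsym (a + k)) \<alpha>)"
  define N where "N = map_mat (translate 1) M"
  define N' where "N' = mat l l (\<lambda>(i, j). N $$ (i, j) + (if j = 0 then 0 else - [:0, 1:] * N $$ (i, j - 1)))"
  have l: "0 < l" using assms by (simp add: l_def)
  have M: "M \<in> carrier_mat l l" and N: "N \<in> carrier_mat l l" and N': "N' \<in> carrier_mat l l"
    by (simp_all add: M_def N_def N'_def l_def jt_mat_def)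
  have M_nth: "M $$ (i, j) = hsym (\<alpha> ! i - int i + int j)" if "i < l" "j < l" for i j
    using that by (simp add: M_def jt_mat_def l_def algebra_simps)
  have N'_nth: "N' $$ (i, j) = (if j = 0 then translate 1 (hsym (\<alpha> ! i - int i)) else [:M $$ (i, j):])"
    if "i < l" "j < l" for i j
  proof (cases j)
    case (Suc j')
    define v where "v = \<alpha> ! i - int i + int j"
    have "M $$ (i, j) = hsym v" "M $$ (i, j') = hsym (v - 1)"
      using that Suc by (simp_all add: M_nth v_def algebra_simps)
    then show ?thesis
      using that Suc translate_1_hsym_diff[of v] M by (simp add: N'_def N_def)
  qed (use that M in \<open>simp add: N'_def N_def M_nth\<close>)
  have "translate 1 (schur \<alpha>) = det N" by (simp add: N_def M_def schur_eq_jt jt_def)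
  also have "\<dots> = det N'" unfolding N'_def by (rule mat_mult_upper_bidiagonal[OF N, symmetric])
  also have "\<dots> = (\<Sum>i<l. N' $$ (i, 0) * cofactor N' i 0)" by (rule laplace_expansion_column[OF N' l])
  also have "\<dots> = (\<Sum>i<l. translate 1 (hsym (\<alpha> ! i - int i)) * [:cofactor M i 0:])"
  proof (rule sum.cong)
    interpret C: comm_ring_hom "\<lambda>x::symfun. [:x:]"
      by unfold_locales (simp_all add: one_pCons)
    fix i assume i: "i \<in> {..<l}"
    have "mat_delete N' i 0 = map_mat (\<lambda>x. [:x:]) (mat_delete M i 0)"
      using M N' by (intro eq_matI) (auto simp: mat_delete_def N'_nth)
    then have "det (mat_delete N' i 0) = [:det (mat_delete M i 0):]" by (simp only: C.hom_det)
    then have "cofactor N' i 0 = (-1) ^ i * [:det (mat_delete M i 0):]"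
      by (simp add: cofactor_def)
    also have "\<dots> = [:cofactor M i 0:]"
      by (cases "even i") (auto simp: cofactor_def)
    finally show "N' $$ (i, 0) * cofactor N' i 0 = translate 1 (hsym (\<alpha> ! i - int i)) * [:cofactor M i 0:]"
      using i l by (simp add: N'_nth)
  qed simp
  finally show ?thesis
    by (simp add: coeff_sum coeff_translate_1_hsym l_def M_def mult.commute)
qed

text \<open>Terms with b > m vanish, so the upper bound may be any \<open>B\<close> beyond m and one
  \<open>B\<close> can serve several m.\<close>

lemma sum_alternating_hsym:
  assumes "m \<le> int B"
  shows "(\<Sum>b\<le>B. (-1) ^ b * esym b * hsym (m - int b)) = (if m = 0 then 1 else 0)"
proof (cases "m < 0")
  case False
  then obtain n where m: "m = int n" by (metis nat_0_le not_less)
  have "(\<Sum>b\<le>B. (-1) ^ b * esym b * hsym (m - int b)) = (\<Sum>b\<le>n. (-1) ^ b * esym b * hsym (m - int b))"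
    using assms m by (intro sum.mono_neutral_right) auto
  also have "\<dots> = (\<Sum>b\<le>n. const ((-1) ^ b) * qsym (-1) b * qsym 1 (n - b))"
    by (rule sum.cong) (auto simp: m esym_eq hsym_eq nat_diff_distrib const.hom_power const.hom_uminus)
  finally show ?thesis by (simp add: sum_alternating_qsym m)
qed simp

text \<open>The adjoint of \<open>vertex (\<lambda>k. hsym (a + k))\<close> replaces the first column of the Jacobi--Trudi matrix
  by an indicator vector.\<close>

lemma hall_schur_Cons:
  assumes "\<mu> \<noteq> []"
  shows "hall (schur (int a # \<alpha>)) (schur \<mu>) = hall (schur \<alpha>)
    (\<Sum>i<length \<mu>. if \<mu> ! i - int i = int a then cofactor (jt_mat (map (\<lambda>a k. hsym (a + k)) \<mu>)) i 0 else 0)"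
proof -
  define C where "C i = cofactor (jt_mat (map (\<lambda>a k. hsym (a + k)) \<mu>)) i 0" for i
  \<comment> \<open>Large enough for the sum defining the vertex operator and for every use of
    \<open>sum_alternating_hsym\<close> below.\<close>
  define B where "B = Max (insert (degree (translate (-1) (schur \<alpha>))) ((\<lambda>i. nat (\<mu> ! i - int i - int a)) ` {..<length \<mu>}))"
  have B1: "degree (translate (-1) (schur \<alpha>)) \<le> B" unfolding B_def by (intro Max_ge) auto
  have B2: "\<mu> ! i - int i - int a \<le> int B" if "i < length \<mu>" for i
  proof -
    have "nat (\<mu> ! i - int i - int a) \<le> B" unfolding B_def using that by (intro Max_ge) auto
    then show ?thesis by simp
  qed
  have hall_sum: "hall (sum F {..B}) g = (\<Sum>b\<le>B. hall (F b) g)" "hall g (sum F {..B}) = (\<Sum>b\<le>B. hall g (F b))" for F g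
    by (induction B) (simp_all add: hall_add_left hall_add_right)
  have sgn: "(-1) ^ b = const ((-1) ^ b)" for b
    by (simp add: const.hom_power const.hom_uminus)
  have "schur (int a # \<alpha>) = (\<Sum>b\<le>B. (-1) ^ b * hsym (int a + int b) * coeff (translate (-1) (schur \<alpha>)) b)"
    unfolding vertex_schur[symmetric] using B1
    by (intro vertex_superset) (auto intro!: coeff_eq_0)
  also have "\<dots> = (\<Sum>b\<le>B. const ((-1) ^ b) * (qsym 1 (a + b) * coeff (translate (-1) (schur \<alpha>)) b))"
    unfolding sgn mult.assoc of_nat_add[symmetric] hsym_of_nat ..
  finally have "hall (schur (int a # \<alpha>)) (schur \<mu>) =
    (\<Sum>b\<le>B. (-1) ^ b * hall (schur \<mu>) (qsym 1 (a + b) * coeff (translate (-1) (schur \<alpha>)) b))"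
    by (simp add: hall_sum hall_const_mult_left hall_const_mult_right hall_commute[of _ "schur \<mu>"])
  \<comment> \<open>The factor h_(a+b) is moved across the form as an adjoint acting on
    \<open>schur \<mu>\<close>, and the adjoint of e_b acting on \<open>schur \<alpha>\<close> is
    moved back as a factor e_b.\<close>
  also have "\<dots> = (\<Sum>b\<le>B. (-1) ^ b * hall (schur \<alpha>) (esym b * coeff (translate 1 (schur \<mu>)) (a + b)))"
    unfolding hall_coeff_translate[symmetric]
    by (subst hall_commute) (simp add: hall_coeff_translate esym_eq)
  also have "\<dots> = hall (schur \<alpha>) (\<Sum>b\<le>B. (-1) ^ b * esym b * coeff (translate 1 (schur \<mu>)) (a + b))"
    by (simp add: hall_sum sgn mult.assoc hall_const_mult_right del: const.hom_power)
  also have "(\<Sum>b\<le>B. (-1) ^ b * esym b * coeff (translate 1 (schur \<mu>)) (a + b)) =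
    (\<Sum>b\<le>B. \<Sum>i<length \<mu>. ((-1) ^ b * esym b * hsym (\<mu> ! i - int i - int a - int b)) * C i)"
    by (simp add: coeff_translate_1_schur[OF assms] C_def sum_distrib_left mult.assoc algebra_simps)
  also have "\<dots> = (\<Sum>i<length \<mu>. (\<Sum>b\<le>B. (-1) ^ b * esym b * hsym (\<mu> ! i - int i - int a - int b)) * C i)"
    unfolding sum_distrib_right by (rule sum.swap)
  also have "\<dots> = (\<Sum>i<length \<mu>. if \<mu> ! i - int i = int a then C i else 0)"
    by (rule sum.cong) (auto simp: sum_alternating_hsym B2)
  finally show ?thesis unfolding C_def .
qed

section \<open>The basis of Schur functions\<close>

definition wt :: "(nat \<Rightarrow>\<^sub>0 nat) \<Rightarrow> nat" where
  "wt m = (\<Sum>i\<in>keys m. Suc i * lookup m i)"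

text \<open>Degrees are integers so that \<open>hsym k\<close> and Schur functions of arbitrary
  integer vectors have the expected degree; a negative degree then forces 0.\<close>

definition homog :: "int \<Rightarrow> symfun \<Rightarrow> bool" where
  "homog d f \<longleftrightarrow> (\<forall>m\<in>keys f. int (wt m) = d)"

lemma wt_add: "wt (m + n) = wt m + wt n"
proof -
  have super: "wt m = (\<Sum>i\<in>K. Suc i * lookup m i)" if "finite K" "keys m \<subseteq> K" for m K
    unfolding wt_def by (rule sum.mono_neutral_left) (use that in \<open>auto simp: in_keys_iff\<close>)
  let ?K = "keys m \<union> keys n"
  have "keys (m + n) \<subseteq> ?K" by (rule Poly_Mapping.keys_add)
  then show ?thesis
    by (simp only: super[of ?K "m + n"] super[of ?K m] super[of ?K n] finite_Un finite_keys
        Un_upper1 Un_upper2 lookup_add distrib_left sum.distrib simp_thms)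
qed

lemma homog_0 [simp]: "homog d 0"
  by (simp add: homog_def)

lemma homog_const [simp]: "homog 0 (const c)"
  by (simp add: homog_def const_def wt_def)

lemma homog_add: "homog d f \<Longrightarrow> homog d g \<Longrightarrow> homog d (f + g)"
  using Poly_Mapping.keys_add[of f g] unfolding homog_def by blast

lemma homog_sum: "(\<And>i. i \<in> I \<Longrightarrow> homog d (F i)) \<Longrightarrow> homog d (sum F I)"
  by (induction I rule: infinite_finite_induct) (auto intro: homog_add)

lemma homog_mult:
  assumes "homog d f" "homog e g"
  shows "homog (d + e) (f * g)"
  unfolding homog_def
proof
  fix m assume "m \<in> keys (f * g)"
  then obtain a b where "m = a + b" "a \<in> keys f" "b \<in> keys g"
    using Poly_Mapping.keys_mult[of f g] by blast
  then show "int (wt m) = d + e" using assms by (simp add: homog_def wt_add)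
qed

lemma homog_prod: "(\<And>i. i \<in> I \<Longrightarrow> homog (d i) (F i)) \<Longrightarrow> homog (sum d I) (prod F I)"
proof (induction I rule: infinite_finite_induct)
  case (insert x F)
  then show ?case by (auto intro: homog_mult)
qed (use homog_const[of 1] in simp_all)

lemma homog_neg: "homog d f \<Longrightarrow> d < 0 \<Longrightarrow> f = 0"
  by (auto simp: homog_def keys_eq_empty[symmetric] simp del: keys_eq_empty)

lemma homog_xvar: "homog (int (Suc i)) (xvar i)"
  by (simp add: homog_def xvar_def wt_def)

lemma homog_qsym: "homog (int n) (qsym \<epsilon> n)"
proof (induction n rule: less_induct)
  case (less n)
  show ?case
  proof (cases n)
    case 0
    then show ?thesis using homog_const[of 1] by simp
  next
    case (Suc m)
    have "homog (int n) (const (\<epsilon> ^ i) * xvar i * qsym \<epsilon> (m - i))" if "i \<le> m" for i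
      using homog_mult[OF homog_mult[OF homog_const[of "\<epsilon> ^ i"] homog_xvar[of i]] less[of "m - i"]] that Suc
      by (simp add: of_nat_diff)
    then have "homog (int n) (\<Sum>i\<le>m. const (\<epsilon> ^ i) * xvar i * qsym \<epsilon> (m - i))"
      by (intro homog_sum) auto
    then show ?thesis
      unfolding Suc qsym.simps(2) using homog_mult[OF homog_const] by fastforce
  qed
qed

lemma homog_hsym: "homog k (hsym k)"
  using homog_qsym[of "nat k" 1] by (cases "k < 0") (simp_all add: hsym_eq)

text \<open>In each term of the Leibniz expansion the shifts p(i) - i add up to 0.\<close>

lemma homog_schur: "homog (sum_list \<alpha>) (schur \<alpha>)"
proof -
  let ?l = "length \<alpha>"
  let ?M = "mat ?l ?l (\<lambda>(i, j). hsym (\<alpha> ! i - int i + int j))"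
  have "homog (sum_list \<alpha>) (signof p * (\<Prod>i = 0..<?l. ?M $$ (i, p i)))" if p: "p permutes {0..<?l}" for p
  proof -
    have "p i < ?l" if "i < ?l" for i using permutes_in_image[OF p, of i] that by simp
    then have "homog (\<Sum>i = 0..<?l. \<alpha> ! i - int i + int (p i)) (\<Prod>i = 0..<?l. ?M $$ (i, p i))"
      by (intro homog_prod) (simp add: homog_hsym)
    moreover have "(\<Sum>i = 0..<?l. int (p i)) = (\<Sum>i = 0..<?l. int i)"
      using sum.permute[OF p, of int] by (simp add: o_def)
    then have "(\<Sum>i = 0..<?l. \<alpha> ! i - int i + int (p i)) = sum_list \<alpha>"
      by (simp add: sum.distrib sum_subtractf sum_list_sum_nth)
    moreover have "signof p = const (signof p)"
      by (simp add: sign_def const.hom_uminus)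
    then have "homog 0 (signof p)" using homog_const by metis
    ultimately show ?thesis using homog_mult by fastforce
  qed
  then show ?thesis
    unfolding schur_def by (subst det_def'[of _ ?l]) (auto intro!: homog_sum)
qed

lemma schur_eq_0: "sum_list \<alpha> < 0 \<Longrightarrow> schur \<alpha> = 0"
  using homog_schur homog_neg by blast

lemma is_partition_Cons_iff:
  "is_partition (a # \<alpha>) \<longleftrightarrow> a > 0 \<and> is_partition \<alpha> \<and> (\<forall>b\<in>set \<alpha>. b \<le> a)"
  by (auto simp: is_partition_def)

lemma sum_list_pos_partition: "is_partition (a # \<alpha>) \<Longrightarrow> sum_list (a # \<alpha>) > 0"
  using sum_list_nonneg[of \<alpha>] by (force simp: is_partition_def)

text \<open>For a partition, \<open>\<mu> ! i - int i\<close> is at most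
  \<open>hd \<mu> - int i\<close>, so only row 0 can reach \<open>a\<close>. The cofactor there is
  the Schur function of the tail.\<close>

lemma hall_schur_step:
  assumes "is_partition (a # \<alpha>)" "is_partition \<mu>" "\<mu> = [] \<or> hd \<mu> \<le> a"
  shows "hall (schur (a # \<alpha>)) (schur \<mu>) =
    (if \<mu> \<noteq> [] \<and> hd \<mu> = a then hall (schur \<alpha>) (schur (tl \<mu>)) else 0)"
proof (cases \<mu>)
  case Nil
  have "lookup (schur (a # \<alpha>)) 0 = 0"
    using homog_schur[of "a # \<alpha>"] sum_list_pos_partition[OF assms(1)]
    by (force simp: homog_def in_keys_iff wt_def)
  then have "hall (schur (a # \<alpha>)) (single 0 1) = 0"
    by (simp only: hall_single_right) simp
  then show ?thesis using Nil by simp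
next
  case (Cons c \<nu>)
  let ?M = "jt_mat (map (\<lambda>a k. hsym (a + k)) \<mu>)"
  have "a > 0" using assms(1) by (simp add: is_partition_Cons_iff)
  then obtain n where a: "a = int n" by (metis zero_less_imp_eq_int)
  have le: "\<mu> ! i - int i \<le> c - int i" if "i < length \<mu>" for i
    using assms(2) that nth_mem[OF that] Cons by (auto simp: is_partition_Cons_iff)
  have "c \<le> a" using assms(3) Cons by simp
  have "mat_delete ?M 0 0 = jt_mat (map (\<lambda>a k. hsym (a + k)) \<nu>)"
    by (intro eq_matI) (auto simp: Cons mat_delete_def jt_mat_def)
  then have cof: "cofactor ?M 0 0 = schur \<nu>"
    by (simp add: cofactor_def schur_eq_jt jt_def)
  have "(\<Sum>i<length \<mu>. if \<mu> ! i - int i = int n then cofactor ?M i 0 else 0) =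
    (\<Sum>i<length \<mu>. if i = 0 then (if c = a then schur \<nu> else 0) else 0)"
  proof (rule sum.cong)
    fix i assume "i \<in> {..<length \<mu>}"
    then have "\<mu> ! i - int i = a \<longleftrightarrow> i = 0 \<and> c = a"
      using le[of i] \<open>c \<le> a\<close> Cons by (cases i) auto
    then show "(if \<mu> ! i - int i = int n then cofactor ?M i 0 else 0) =
      (if i = 0 then (if c = a then schur \<nu> else 0) else 0)"
      using cof by (simp add: a)
  qed simp
  also have "\<dots> = (if c = a then schur \<nu> else 0)" by (simp add: Cons)
  finally show ?thesis
    using hall_schur_Cons[of \<mu> n \<alpha>] Cons by (simp add: a)
qed

text \<open>Symmetry of the form lets the partition with the larger first part take the role of
  \<open>a # \<alpha>\<close> in \<open>hall_schur_step\<close>; hence the two mirrored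
  claims.\<close>

lemma hall_schur:
  "is_partition \<mu> \<Longrightarrow> is_partition \<nu> \<Longrightarrow> hall (schur \<mu>) (schur \<nu>) = (if \<mu> = \<nu> then 1 else 0)"
proof (induction "length \<mu> + length \<nu>" arbitrary: \<mu> \<nu> rule: less_induct)
  case less
  have *: ?case if \<mu>: "\<mu> = a # \<alpha>" and le: "\<nu> = [] \<or> hd \<nu> \<le> a" for a \<alpha>
  proof -
    have part: "is_partition \<alpha>" "is_partition (tl \<nu>)"
      using less.prems \<mu> by (auto simp: is_partition_Cons_iff) (cases \<nu>; auto simp: is_partition_Cons_iff)
    have "hall (schur \<mu>) (schur \<nu>) = (if \<nu> \<noteq> [] \<and> hd \<nu> = a then hall (schur \<alpha>) (schur (tl \<nu>)) else 0)"
      unfolding \<mu> by (rule hall_schur_step) (use less.prems \<mu> le in auto)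
    also have "hall (schur \<alpha>) (schur (tl \<nu>)) = (if \<alpha> = tl \<nu> then 1 else 0)"
      by (rule less.hyps) (use part \<mu> in auto)
    finally show ?thesis unfolding \<mu> by (cases \<nu>) auto
  qed
  have **: ?case if \<nu>: "\<nu> = a # \<alpha>" and le: "\<mu> = [] \<or> hd \<mu> \<le> a" for a \<alpha>
  proof -
    have part: "is_partition \<alpha>" "is_partition (tl \<mu>)"
      using less.prems \<nu> by (auto simp: is_partition_Cons_iff) (cases \<mu>; auto simp: is_partition_Cons_iff)
    have "hall (schur \<nu>) (schur \<mu>) = (if \<mu> \<noteq> [] \<and> hd \<mu> = a then hall (schur \<alpha>) (schur (tl \<mu>)) else 0)"
      unfolding \<nu> by (rule hall_schur_step) (use less.prems \<nu> le in auto)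
    also have "hall (schur \<alpha>) (schur (tl \<mu>)) = (if tl \<mu> = \<alpha> then 1 else 0)"
      using less.hyps[of "tl \<mu>" \<alpha>] part \<nu> by (simp add: hall_commute)
    finally show ?thesis unfolding \<nu> by (cases \<mu>) (auto simp: hall_commute)
  qed
  show ?case
  proof (cases \<mu>)
    case Nil
    have "hall 1 (single 0 1) = (1::complex)"
      by (simp only: hall_single_right) (simp add: zee_def)
    then show ?thesis using Nil ** by (cases \<nu>) auto
  next
    case (Cons a \<alpha>)
    show ?thesis
    proof (cases "\<nu> = [] \<or> hd \<nu> \<le> a")
      case True
      then show ?thesis using * Cons by blast
    next
      case False
      then obtain c \<beta> where "\<nu> = c # \<beta>" "a \<le> c" by (cases \<nu>) auto
      then show ?thesis using ** Cons by auto
    qed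
  qed
qed

section \<open>Schur functions of partitions span the ring\<close>

interpretation symfun: vector_space "\<lambda>c f. const c * f"
  by unfold_locales (simp_all add: const.hom_add const.hom_mult distrib_left distrib_right mult.assoc)

text \<open>The cofactors along a row do not involve that row. The ring is general because the lemma
  is applied over polynomials in t.\<close>

lemma jt_linear:
  "jt (xs @ (\<lambda>k. \<rho> k + c * \<sigma> k) # ys) = jt (xs @ \<rho> # ys) + c * jt (xs @ \<sigma> # ys)"
proof -
  define n where "n = Suc (length xs + length ys)"
  define C where "C j = cofactor (jt_mat (xs @ \<rho> # ys)) (length xs) j" for j
  have jt: "jt (xs @ \<tau> # ys) = (\<Sum>j<n. \<tau> (int j - int (length xs)) * C j)" for \<tau>
  proof -
    have "mat_delete (jt_mat (xs @ \<tau> # ys)) (length xs) j = mat_delete (jt_mat (xs @ \<rho> # ys)) (length xs) j" for j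
      by (intro eq_matI) (auto simp: mat_delete_def jt_mat_def nth_append)
    then have C: "cofactor (jt_mat (xs @ \<tau> # ys)) (length xs) j = C j" for j
      by (simp add: C_def cofactor_def)
    have "jt (xs @ \<tau> # ys) =
      (\<Sum>j<n. jt_mat (xs @ \<tau> # ys) $$ (length xs, j) * cofactor (jt_mat (xs @ \<tau> # ys)) (length xs) j)"
      unfolding jt_def by (rule laplace_expansion_row) (simp_all add: n_def jt_mat_def)
    then show ?thesis by (simp add: C) (simp add: jt_mat_def n_def)
  qed
  show ?thesis unfolding jt by (simp add: distrib_right sum.distrib sum_distrib_left mult.assoc)
qed

text \<open>By linearity in the rows, since translation replaces the row of \<open>\<alpha>\<^sub>i\<close> by itself plus \<open>t\<close> times
  the row of \<open>\<alpha>\<^sub>i - 1\<close>.\<close>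

lemma coeff_translate_schur_in_span:
  "coeff (translate (-1) (schur \<alpha>)) j \<in> symfun.span (schur ` {\<beta>. sum_list \<beta> = sum_list \<alpha> - int j})"
proof -
  define C where "C a = (\<lambda>k. [:hsym (a + k):])" for a
  define D where "D a = (\<lambda>k. C a k + [:0, 1:] * C (a - 1) k)" for a
  interpret P: comm_ring_hom "\<lambda>x::symfun. [:x:]"
    by unfold_locales (simp_all add: one_pCons)
  have det: "jt (map C \<beta>) = [:schur \<beta>:]" for \<beta>
  proof -
    have "jt_mat (map C \<beta>) = map_mat (\<lambda>x. [:x:]) (jt_mat (map (\<lambda>a k. hsym (a + k)) \<beta>))"
      by (intro eq_matI) (auto simp: jt_mat_def C_def)
    then show ?thesis by (simp only: jt_def schur_eq_jt P.hom_det)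
  qed
  \<comment> \<open>The rows of \<beta> are already split, those of \<alpha> are not. Choosing the
    shifted row uses up one power of t, so j varies with \<beta>.\<close>
  have span: "coeff (jt (map C \<beta> @ map D \<alpha>)) j \<in>
    symfun.span (schur ` {\<gamma>. sum_list \<gamma> = sum_list \<beta> + sum_list \<alpha> - int j})" for \<beta> j
  proof (induction \<alpha> arbitrary: \<beta> j)
    case Nil
    show ?case by (cases j) (auto simp: det coeff_pCons symfun.span_zero intro!: symfun.span_base)
  next
    case (Cons a \<alpha>)
    have "jt (map C \<beta> @ map D (a # \<alpha>)) =
      jt (map C (\<beta> @ [a]) @ map D \<alpha>) + [:0, 1:] * jt (map C (\<beta> @ [a - 1]) @ map D \<alpha>)"
      by (simp add: D_def[of a] jt_linear del: mult_pCons_left)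
    moreover have "coeff (jt (map C (\<beta> @ [a]) @ map D \<alpha>)) j \<in>
      symfun.span (schur ` {\<gamma>. sum_list \<gamma> = sum_list \<beta> + sum_list (a # \<alpha>) - int j})"
      using Cons[of "\<beta> @ [a]" j] by (simp add: algebra_simps)
    moreover have "coeff ([:0, 1:] * jt (map C (\<beta> @ [a - 1]) @ map D \<alpha>)) j \<in>
      symfun.span (schur ` {\<gamma>. sum_list \<gamma> = sum_list \<beta> + sum_list (a # \<alpha>) - int j})"
    proof (cases j)
      case (Suc i)
      then show ?thesis using Cons[of "\<beta> @ [a - 1]" i] by (simp add: algebra_simps)
    qed (simp add: symfun.span_zero)
    ultimately show ?case by (simp add: symfun.span_add del: mult_pCons_left)
  qed
  have "map_mat (translate (-1)) (jt_mat (map (\<lambda>a k. hsym (a + k)) \<alpha>)) = jt_mat (map D \<alpha>)"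
    by (intro eq_matI) (auto simp: jt_mat_def C_def D_def translate_hsym algebra_simps)
  then have "translate (-1) (schur \<alpha>) = jt (map D \<alpha>)"
    by (simp add: schur_eq_jt jt_def flip: translate.hom_det)
  then show ?thesis using span[of "[]"] by simp
qed

text \<open>The indices in the last row are a - l + j with j \<le> l, hence at most 0. Only the
  corner can be nonzero, and it is 1 exactly for a = 0.\<close>

lemma schur_append_nonpos:
  assumes "a \<le> 0"
  shows "schur (\<mu> @ [a]) = (if a = 0 then schur \<mu> else 0)"
proof -
  define l where "l = length \<mu>"
  define M where "M = jt_mat (map (\<lambda>a k. hsym (a + k)) (\<mu> @ [a]))"
  have M: "M \<in> carrier_mat (Suc l) (Suc l)" by (simp add: M_def l_def jt_mat_def)
  have M_last: "M $$ (l, j) = (if j = l \<and> a = 0 then 1 else 0)" if "j < Suc l" for j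
    using that assms by (auto simp: M_def jt_mat_def l_def nth_append)
  have "schur (\<mu> @ [a]) = (\<Sum>j<Suc l. M $$ (l, j) * cofactor M l j)"
    unfolding schur_eq_jt jt_def M_def[symmetric] by (rule laplace_expansion_row[OF M]) simp
  also have "\<dots> = (\<Sum>j<Suc l. if j = l then (if a = 0 then cofactor M l l else 0) else 0)"
    by (intro sum.cong) (auto simp: M_last)
  also have "\<dots> = (if a = 0 then cofactor M l l else 0)" by simp
  also have "cofactor M l l = det (mat_delete M l l)" by (simp add: cofactor_def)
  also have "mat_delete M l l = jt_mat (map (\<lambda>a k. hsym (a + k)) \<mu>)"
    by (intro eq_matI) (auto simp: M_def mat_delete_def jt_mat_def l_def nth_append)
  finally show ?thesis by (simp add: schur_eq_jt jt_def)
qed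

abbreviation schur_span where
  "schur_span \<equiv> symfun.span (schur ` {\<mu>. is_partition \<mu>})"

lemma schur_decreasing_in_span: "sorted_wrt (\<ge>) \<alpha> \<Longrightarrow> schur \<alpha> \<in> schur_span"
proof (induction \<alpha> rule: rev_induct)
  case Nil
  show ?case by (rule symfun.span_base) (auto simp: is_partition_def intro: image_eqI[of _ _ "[]"])
next
  case (snoc a \<mu>)
  show ?case
  proof (cases "a \<le> 0")
    case True
    then show ?thesis using snoc by (auto simp: schur_append_nonpos sorted_wrt_append symfun.span_zero)
  next
    case False
    then have "is_partition (\<mu> @ [a])" using snoc by (force simp: is_partition_def sorted_wrt_append)
    then show ?thesis by (auto intro: symfun.span_base)
  qed
qed

text \<open>Straightening: row i depends only on \<alpha>_i - i. If two of these numbers agree, the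
  determinant is 0; otherwise sorting them permutes the rows, and strict decrease of the shifted
  numbers is weak decrease of the new vector.\<close>

lemma schur_in_span: "schur \<alpha> \<in> schur_span"
proof -
  define l where "l = length \<alpha>"
  define c where "c = map (\<lambda>i. \<alpha> ! i - int i) [0..<l]"
  define M where "M = mat l l (\<lambda>(i, j). hsym (c ! i + int j))"
  have M: "M \<in> carrier_mat l l" by (simp add: M_def)
  have schur: "schur \<alpha> = det M"
    by (auto simp: schur_def M_def c_def l_def intro!: arg_cong[of _ _ det])
  show ?thesis
  proof (cases "distinct c")
    case False
    then obtain i j where ij: "i < l" "j < l" "i \<noteq> j" "c ! i = c ! j"
      by (auto simp: distinct_conv_nth c_def)
    then have "det M = 0"
      by (intro det_identical_rows[OF M ij(3,1,2)]) (auto simp: M_def intro!: eq_vecI)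
    then show ?thesis by (simp add: schur symfun.span_zero)
  next
    case True
    define c' where "c' = rev (sort c)"
    define \<alpha>' where "\<alpha>' = map (\<lambda>i. c' ! i + int i) [0..<l]"
    have len: "length c' = l" by (simp add: c'_def c_def)
    obtain p where p: "p permutes {..<length c}" "permute_list p c = c'"
      using mset_eq_permutation[of c' c] by (auto simp: c'_def)
    have p': "p permutes {0..<l}" using p(1) by (simp add: c_def lessThan_atLeast0)
    have c'_nth: "c' ! i = c ! p i" if "i < l" for i
      using that p(1) by (simp add: p(2)[symmetric] permute_list_nth c_def)
    have "mat l l (\<lambda>(i, j). M $$ (p i, j)) = mat l l (\<lambda>(i, j). hsym (\<alpha>' ! i - int i + int j))"
      using permutes_in_image[OF p'] by (intro eq_matI) (auto simp: M_def \<alpha>'_def c'_nth)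
    then have "schur \<alpha>' = signof p * det M"
      using det_permute_rows[OF M p'] by (simp add: schur_def \<alpha>'_def)
    then have "signof p * schur \<alpha>' = (signof p * signof p) * det M" by (simp only: mult.assoc)
    also have "signof p * signof p = (1::symfun)" by (simp add: sign_def)
    finally have "schur \<alpha> = const (signof p) * schur \<alpha>'"
      by (simp add: schur sign_def const.hom_uminus split: if_splits)
    moreover have "sorted_wrt (>) c'"
      using True by (simp add: c'_def sorted_wrt_rev strict_sorted_iff)
    then have "sorted_wrt (\<ge>) \<alpha>'"
    proof -
      have step: "c' ! Suc i + 1 \<le> c' ! i" if "Suc i < l" for i
        using \<open>sorted_wrt (>) c'\<close> that len by (force simp: sorted_wrt_iff_nth_less)
      have "transp ((\<ge>) :: int \<Rightarrow> int \<Rightarrow> bool)" by (auto intro: transpI)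
      then show ?thesis
        using step by (subst sorted_wrt_iff_nth_Suc_transp) (auto simp: \<alpha>'_def)
    qed
    ultimately show ?thesis
      using schur_decreasing_in_span by (simp only: symfun.span_scale)
  qed
qed

lemma coeff_translate_0: "coeff (translate \<epsilon> f) 0 = f"
  by (induction f rule: mpoly_induct) (simp_all add: translate.hom_add translate.hom_mult coeff_mult)

text \<open>The product is the term b = 0 of the vertex operator that prepends \<open>a\<close>. The
  other terms contain coefficients of t^b in the translated Schur function, whose degree is lower by
  b, so induction on the degree applies.\<close>

lemma hsym_mult_schur_in_span: "hsym a * schur \<alpha> \<in> schur_span"
proof (induction "nat (sum_list \<alpha>)" arbitrary: a \<alpha> rule: less_induct)
  case less
  show ?case
  proof (cases "sum_list \<alpha> < 0")
    case True
    then show ?thesis by (simp add: schur_eq_0 symfun.span_zero)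
  next
    case False
    let ?c = "coeff (translate (-1) (schur \<alpha>))" and ?d = "degree (translate (-1) (schur \<alpha>))"
    have step: "hsym k * f \<in> schur_span"
      if "f \<in> symfun.span (schur ` {\<beta>. sum_list \<beta> = sum_list \<alpha> - int b})" "b \<noteq> 0" for k f b
      using that(1)
    proof (induction f rule: symfun.span_induct_alt)
      case base
      show ?case by (simp add: symfun.span_zero)
    next
      case (step c x y)
      then obtain \<beta> where \<beta>: "x = schur \<beta>" "sum_list \<beta> = sum_list \<alpha> - int b" by auto
      have "hsym k * x \<in> schur_span"
      \<comment> \<open>\<open>nat\<close> flattens negative degrees, so the induction does not
        reach them; the Schur function is 0 there.\<close>
      proof (cases "sum_list \<beta> < 0")
        case True
        then show ?thesis by (simp add: \<beta> schur_eq_0 symfun.span_zero)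
      next
        case nonneg: False
        then show ?thesis unfolding \<beta>(1) using \<beta>(2) that(2) by (intro less) auto
      qed
      moreover have "hsym k * (const c * x + y) = const c * (hsym k * x) + hsym k * y"
        by (simp add: algebra_simps)
      ultimately show ?case using step by (simp only: symfun.span_add symfun.span_scale)
    qed
    have "schur (a # \<alpha>) = (\<Sum>b\<in>insert 0 {1..?d}. (-1) ^ b * hsym (a + int b) * ?c b)"
      unfolding vertex_schur[symmetric] by (rule vertex_superset) (auto intro: coeff_eq_0)
    then have eq: "hsym a * schur \<alpha> = schur (a # \<alpha>) - (\<Sum>b\<in>{1..?d}. const ((-1) ^ b) * (hsym (a + int b) * ?c b))"
      by (subst (asm) sum.insert) (auto simp: coeff_translate_0 const.hom_power const.hom_uminus mult.assoc)
    have "hsym (a + int b) * ?c b \<in> schur_span" if "b \<in> {1..?d}" for b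
      using that by (intro step[OF coeff_translate_schur_in_span]) auto
    then show ?thesis unfolding eq
      by (intro symfun.span_diff symfun.span_sum symfun.span_scale schur_in_span)
  qed
qed

lemma schur_span_UNIV: "f \<in> schur_span"
proof (induction f rule: symfun_induct_qsym)
  case (const c)
  then show ?case using symfun.span_scale[OF schur_in_span[of "[]"], of c] by simp
next
  case (qsym f n)
  then show ?case
  proof (induction f rule: symfun.span_induct_alt)
    case (step c x y)
    then obtain \<mu> where "x = schur \<mu>" by auto
    then have "qsym 1 n * x \<in> schur_span"
      using hsym_mult_schur_in_span[of "int n" \<mu>] by simp
    moreover have "qsym 1 n * (const c * x + y) = const c * (qsym 1 n * x) + qsym 1 n * y"
      by (simp add: algebra_simps)
    ultimately show ?case using step by (simp only: symfun.span_add symfun.span_scale)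
  qed (simp add: symfun.span_zero)
qed (auto intro: symfun.span_add symfun.span_scale)

section \<open>Identification of the scalar product, the adjoints and the vertex operators\<close>

lemma bilinear_form_unique:
  assumes "bilinear_form \<beta>" "bilinear_form \<gamma>"
    and eq: "\<And>\<mu> \<nu>. is_partition \<mu> \<Longrightarrow> is_partition \<nu> \<Longrightarrow> \<beta> (schur \<mu>) (schur \<nu>) = \<gamma> (schur \<mu>) (schur \<nu>)"
  shows "\<beta> = \<gamma>"
proof (intro ext)
  have zero: "\<delta> 0 w = 0" "\<delta> w 0 = 0" if "bilinear_form \<delta>" for \<delta> w
    using that const_eq_0_iff[of 0] unfolding bilinear_form_def by (metis mult_zero_left)+
  note bil = assms(1,2)[unfolded bilinear_form_def]
  have 1: "\<beta> f (schur \<nu>) = \<gamma> f (schur \<nu>)" if "is_partition \<nu>" for f \<nu>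
    using schur_span_UNIV[of f]
    by (induction f rule: symfun.span_induct_alt) (use bil eq that in \<open>auto simp: zero assms(1,2)\<close>)
  fix f g
  show "\<beta> f g = \<gamma> f g"
    using schur_span_UNIV[of g]
    by (induction g rule: symfun.span_induct_alt) (use bil 1 in \<open>auto simp: zero assms(1,2)\<close>)
qed

lemma scalar_product_eq_hall: "scalar_product = hall"
  unfolding scalar_product_def
proof (rule the_equality)
  show "bilinear_form hall \<and> (\<forall>\<mu> \<nu>. is_partition \<mu> \<longrightarrow> is_partition \<nu> \<longrightarrow>
    hall (schur \<mu>) (schur \<nu>) = (if \<mu> = \<nu> then 1 else 0))"
    by (simp add: bilinear_form_hall hall_schur)
qed (rule bilinear_form_unique, auto simp: bilinear_form_hall hall_schur)

lemma perp_esym: "perp (esym b) f = coeff (translate (-1) f) b"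
  unfolding perp_def scalar_product_eq_hall esym_eq
  by (rule the_equality) (auto simp: hall_coeff_translate intro: hall_nondegenerate)

lemma Gam_eq_vertex: "Gam j f = vertex (\<lambda>k. hsym (k - j)) f"
  unfolding Gam_def perp_esym vertex_def
  by (rule Sum_any.expand_superset) (auto intro: le_degree)

lemma Gam_schur: "Gam (- a) (schur \<alpha>) = schur (a # \<alpha>)"
  using vertex_schur[of a \<alpha>] by (simp add: Gam_eq_vertex add.commute)

lemma gen_fun_eq_schur: "gen_fun \<alpha> = schur \<alpha>"
  by (induction \<alpha>) (simp_all add: gen_fun_def Gam_schur)

section \<open>Deformed Schur functions\<close>

text \<open>The sign converts the offset j - i of \<open>jt_mat\<close> into the second index i - j
  of \<open>h_tilde\<close>.\<close>

definition h_row :: "(int \<Rightarrow> int \<Rightarrow> complex) \<Rightarrow> int \<Rightarrow> int \<Rightarrow> symfun" where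
  "h_row A k = (\<lambda>m. h_tilde A k (- m))"

text \<open>Beyond U the entries of A vanish, and below -L the index r + m is negative. The same
  interval serves all m \<le> L, so sums for different offsets can be combined.\<close>

lemma h_row_eq_sum:
  assumes "\<And>j. j < - U \<Longrightarrow> A (- k) j = 0" and "- L \<le> - m"
  shows "h_row A k m = (\<Sum>r\<in>{- L..U}. const (A (- k) (- r)) * hsym (r + m))"
proof -
  have "const (A (- k) (- r)) * hsym (r + m) = 0" if "r \<notin> {- L..U}" for r
  proof (cases "r < - L")
    case True
    then show ?thesis using assms(2) by simp
  next
    case False
    then have "A (- k) (- r) = 0" using that by (intro assms(1)) auto
    then show ?thesis by simp
  qed
  then have "{r. const (A (- k) (- r)) * hsym (r + m) \<noteq> 0} \<subseteq> {- L..U}" by blast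
  from Sum_any.expand_superset[OF _ this] show ?thesis
    by (simp add: h_row_def h_tilde_def)
qed

lemma jt_row_h_row:
  assumes "\<And>j. j < N \<Longrightarrow> A (- k) j = 0"
  shows "jt_row (h_row A k)"
  unfolding jt_row_def
proof
  fix m
  have sum: "h_row A k m' = (\<Sum>r\<in>{- m..- N}. const (A (- k) (- r)) * hsym (r + m'))" if "m' \<le> m" for m'
    using that assms by (intro h_row_eq_sum) auto
  have "translate (-1) (h_row A k m) =
    (\<Sum>r\<in>{- m..- N}. [:const (A (- k) (- r)) * hsym (r + m), const (A (- k) (- r)) * hsym (r + (m - 1)):])"
    by (simp add: sum translate.hom_sum translate.hom_mult translate_hsym algebra_simps)
  then show "translate (-1) (h_row A k m) = [:h_row A k m, h_row A k (m - 1):]"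
    by (intro poly_eqI) (auto simp: sum coeff_sum coeff_pCons split: nat.split)
qed

text \<open>\<open>Gam j f\<close> vanishes for j beyond the degree of the translate of f, and the
  row of A vanishes below N. The sum is therefore finite and can be exchanged with the one over b,
  which leaves the entries of \<open>h_row\<close>.\<close>

lemma Gam_tilde_eq_vertex:
  assumes "\<And>j. j < N \<Longrightarrow> A (- k) j = 0"
  shows "Gam_tilde A (- k) f = vertex (h_row A k) f"
proof -
  let ?d = "degree (translate (-1) f)" and ?c = "coeff (translate (-1) f)"
  have "const (A (- k) j) * Gam j f = 0" if "j \<notin> {N..int ?d}" for j
  proof (cases "j < N")
    case False
    then have "Gam j f = 0" using that by (auto simp: Gam_eq_vertex vertex_def intro!: sum.neutral)
    then show ?thesis by simp
  qed (simp add: assms)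
  then have "{j. const (A (- k) j) * Gam j f \<noteq> 0} \<subseteq> {N..int ?d}" by blast
  from Sum_any.expand_superset[OF _ this]
  have "Gam_tilde A (- k) f = (\<Sum>j\<in>{N..int ?d}. const (A (- k) j) * Gam j f)"
    by (simp add: Gam_tilde_def)
  also have "\<dots> = (\<Sum>r\<in>{- int ?d..- N}. const (A (- k) (- r)) * Gam (- r) f)"
    by (rule sum.reindex_bij_witness[of _ uminus uminus]) auto
  also have "\<dots> = (\<Sum>r\<in>{- int ?d..- N}. \<Sum>b\<le>?d.
      (-1) ^ b * (const (A (- k) (- r)) * hsym (r + int b)) * ?c b)"
    by (simp add: Gam_eq_vertex vertex_def sum_distrib_left algebra_simps)
  also have "\<dots> = (\<Sum>b\<le>?d. (-1) ^ b * (\<Sum>r\<in>{- int ?d..- N}. const (A (- k) (- r)) * hsym (r + int b)) * ?c b)"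
    by (subst sum.swap) (simp add: sum_distrib_left sum_distrib_right)
  also have "\<dots> = (\<Sum>b\<le>?d. (-1) ^ b * h_row A k (int b) * ?c b)"
    by (rule sum.cong) (use assms in \<open>auto simp: h_row_eq_sum[where L = "int ?d" and U = "- N"]\<close>)
  finally show ?thesis by (simp add: vertex_def)
qed

lemma vertex_add: "vertex \<rho> (f + g) = vertex \<rho> f + vertex \<rho> g"
proof -
  let ?K = "{..degree (translate (-1) f) + degree (translate (-1) g)}"
  have "vertex \<rho> (f + g) = (\<Sum>b\<in>?K. (-1) ^ b * \<rho> (int b) * coeff (translate (-1) (f + g)) b)"
    by (rule vertex_superset) (auto simp: translate.hom_add coeff_eq_0)
  moreover have "vertex \<rho> f = (\<Sum>b\<in>?K. (-1) ^ b * \<rho> (int b) * coeff (translate (-1) f) b)"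
    by (rule vertex_superset) (auto simp: coeff_eq_0)
  moreover have "vertex \<rho> g = (\<Sum>b\<in>?K. (-1) ^ b * \<rho> (int b) * coeff (translate (-1) g) b)"
    by (rule vertex_superset) (auto simp: coeff_eq_0)
  ultimately show ?thesis
    by (simp add: translate.hom_add distrib_left sum.distrib)
qed

lemma vertex_const_mult: "vertex \<rho> (const c * f) = const c * vertex \<rho> f"
proof -
  let ?K = "{..degree (translate (-1) f)}"
  have "vertex \<rho> (const c * f) = (\<Sum>b\<in>?K. (-1) ^ b * \<rho> (int b) * coeff (translate (-1) (const c * f)) b)"
    by (rule vertex_superset) (auto simp: translate.hom_mult coeff_eq_0)
  then show ?thesis
    by (simp add: vertex_def translate.hom_mult sum_distrib_left mult_ac)
qed

lemma vertex_sum: "vertex \<rho> (sum F I) = (\<Sum>i\<in>I. vertex \<rho> (F i))"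
proof (induction I rule: infinite_finite_induct)
  case (insert x I)
  then show ?case by (simp add: vertex_add)
qed (simp_all add: vertex_def)

context
  fixes A :: "int \<Rightarrow> int \<Rightarrow> complex"
  assumes rows: "\<forall>i. \<exists>N. \<forall>j<N. A i j = 0"
begin

lemma s_tilde_Cons: "s_tilde A (k # \<mu>) = vertex (h_row A k) (s_tilde A \<mu>)"
proof -
  obtain N where "\<forall>j<N. A (- k) j = 0" using rows by blast
  then show ?thesis
    by (simp add: s_tilde_def Gam_tilde_eq_vertex[of N])
qed

lemma s_tilde_eq_jt: "s_tilde A \<mu> = jt (map (h_row A) \<mu>)"
proof (induction \<mu>)
  case Nil
  show ?case by (simp add: s_tilde_def)
next
  case (Cons k \<mu>)
  have "jt_row (h_row A k)" for k
    using rows jt_row_h_row[of _ A k] by blast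
  then show ?case by (simp add: s_tilde_Cons Cons vertex_jt image_iff) (subst vertex_jt; auto)
qed

lemma vertex_h_row_schur:
  assumes "\<And>j. j < - U \<Longrightarrow> A (- k) j = 0" "int (length \<alpha>) \<le> L"
  shows "vertex (h_row A k) (schur \<alpha>) = (\<Sum>r\<in>{- L..U}. const (A (- k) (- r)) * schur (r # \<alpha>))"
proof -
  let ?c = "coeff (translate (-1) (schur \<alpha>))"
  have 0: "?c b = 0" if "b \<notin> {..length \<alpha>}" for b
    using that unfolding schur_eq_jt
    by (subst coeff_translate_jt[where \<rho> = "\<lambda>_. 0"]) (auto simp: jt_row_hsym)
  have "vertex (h_row A k) (schur \<alpha>) = (\<Sum>b\<le>length \<alpha>. (-1) ^ b * h_row A k (int b) * ?c b)"
    by (rule vertex_superset) (use 0 in auto)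
  also have "\<dots> = (\<Sum>b\<le>length \<alpha>. (-1) ^ b * (\<Sum>r\<in>{- L..U}. const (A (- k) (- r)) * hsym (r + int b)) * ?c b)"
    by (rule sum.cong) (use assms in \<open>auto simp: h_row_eq_sum[where L = L and U = U]\<close>)
  also have "\<dots> = (\<Sum>r\<in>{- L..U}. const (A (- k) (- r)) * (\<Sum>b\<le>length \<alpha>. (-1) ^ b * hsym (r + int b) * ?c b))"
    by (subst (2) sum_distrib_left, subst sum.swap) (simp add: sum_distrib_left sum_distrib_right mult_ac)
  also have "\<dots> = (\<Sum>r\<in>{- L..U}. const (A (- k) (- r)) * schur (r # \<alpha>))"
  proof (rule sum.cong)
    fix r
    have "vertex (\<lambda>k. hsym (r + k)) (schur \<alpha>) = (\<Sum>b\<le>length \<alpha>. (-1) ^ b * hsym (r + int b) * ?c b)"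
      by (rule vertex_superset) (use 0 in auto)
    then show "const (A (- k) (- r)) * (\<Sum>b\<le>length \<alpha>. (-1) ^ b * hsym (r + int b) * ?c b) =
      const (A (- k) (- r)) * schur (r # \<alpha>)" by (simp add: vertex_schur)
  qed simp
  finally show ?thesis .
qed

text \<open>\<open>L\<close> may exceed the length, so the induction keeps one box of entries for
  vectors of all lengths.\<close>

lemma s_tilde_eq_sum:
  assumes "\<And>k j. k \<in> set \<mu> \<Longrightarrow> j < - U \<Longrightarrow> A (- k) j = 0" "int (length \<mu>) \<le> L"
  shows "s_tilde A \<mu> = (\<Sum>\<alpha> | set \<alpha> \<subseteq> {- L..U} \<and> length \<alpha> = length \<mu>.
    const (\<Prod>i<length \<mu>. A (- (\<mu> ! i)) (- (\<alpha> ! i))) * schur \<alpha>)"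
  using assms
proof (induction \<mu>)
  case Nil
  have "{\<alpha>. set \<alpha> \<subseteq> {- L..U} \<and> \<alpha> = []} = {[]}" by auto
  then show ?case by (simp add: s_tilde_def)
next
  case (Cons k \<mu>)
  let ?X = "\<lambda>l. {\<alpha>. set \<alpha> \<subseteq> {- L..U} \<and> length \<alpha> = l}"
  let ?c = "\<lambda>\<alpha>. \<Prod>i<length \<mu>. A (- (\<mu> ! i)) (- (\<alpha> ! i))"
  have "s_tilde A (k # \<mu>) = (\<Sum>\<alpha>\<in>?X (length \<mu>). const (?c \<alpha>) * vertex (h_row A k) (schur \<alpha>))"
    unfolding s_tilde_Cons using Cons by (subst Cons.IH) (auto simp: vertex_sum vertex_const_mult)
  also have "\<dots> = (\<Sum>\<alpha>\<in>?X (length \<mu>). \<Sum>r\<in>{- L..U}. const (A (- k) (- r) * ?c \<alpha>) * schur (r # \<alpha>))"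
  proof (rule sum.cong)
    fix \<alpha> assume "\<alpha> \<in> ?X (length \<mu>)"
    then have "vertex (h_row A k) (schur \<alpha>) = (\<Sum>r\<in>{- L..U}. const (A (- k) (- r)) * schur (r # \<alpha>))"
      using Cons.prems by (intro vertex_h_row_schur) auto
    then show "const (?c \<alpha>) * vertex (h_row A k) (schur \<alpha>) =
      (\<Sum>r\<in>{- L..U}. const (A (- k) (- r) * ?c \<alpha>) * schur (r # \<alpha>))"
      by (simp add: sum_distrib_left const.hom_mult mult_ac)
  qed simp
  also have "\<dots> = (\<Sum>(\<alpha>, r)\<in>?X (length \<mu>) \<times> {- L..U}. const (A (- k) (- r) * ?c \<alpha>) * schur (r # \<alpha>))"
    by (rule sum.cartesian_product)
  also have "\<dots> = (\<Sum>\<beta>\<in>?X (length (k # \<mu>)). const (\<Prod>i<length (k # \<mu>). A (- ((k # \<mu>) ! i)) (- (\<beta> ! i))) * schur \<beta>)"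
    unfolding length_Cons lists_length_Suc_eq
    by (subst sum.reindex) (auto intro!: sum.cong inj_onI simp: prod.lessThan_Suc_shift simp del: prod.lessThan_Suc)
  finally show ?case .
qed

end

section \<open>Expansions in Schur functions and their inversion\<close>

lemma has_finite_sumI:
  assumes "finite F" "F \<subseteq> I" "\<And>i. i \<in> I - F \<Longrightarrow> a i = 0" "sum a F = s"
  shows "has_finite_sum a I s"
proof -
  have sub: "{i \<in> I. a i \<noteq> 0} \<subseteq> F" using assms(3) by blast
  then have "sum a {i \<in> I. a i \<noteq> 0} = sum a F"
    using assms(1,2) by (intro sum.mono_neutral_left) auto
  then show ?thesis using finite_subset[OF sub assms(1)] assms(4) by (simp add: has_finite_sum_def)
qed

lemma has_finite_sumD:
  assumes "has_finite_sum a I s" "finite F" "F \<subseteq> I" "\<And>i. i \<in> I - F \<Longrightarrow> a i = 0"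
  shows "sum a F = s"
proof -
  have "sum a {i \<in> I. a i \<noteq> 0} = sum a F"
    using assms(2-4) by (intro sum.mono_neutral_left) auto
  then show ?thesis using assms(1) by (simp add: has_finite_sum_def)
qed

lemma schur_eq_0_of_entry:
  assumes "i < length \<alpha>" "\<alpha> ! i \<le> - int (length \<alpha>)"
  shows "schur \<alpha> = 0"
proof -
  let ?M = "mat (length \<alpha>) (length \<alpha>) (\<lambda>(i, j). hsym (\<alpha> ! i - int i + int j))"
  have "det ?M = (\<Sum>j<length \<alpha>. ?M $$ (i, j) * cofactor ?M i j)"
    by (rule laplace_expansion_row) (use assms in auto)
  also have "\<dots> = 0" using assms by (intro sum.neutral) auto
  finally show ?thesis by (simp add: schur_def)
qed

text \<open>Outside the box, an entry below -l makes a row of the Jacobi--Trudi matrix 0, and an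
  entry above U makes a factor of the coefficient 0.\<close>

lemma s_tilde_has_finite_sum:
  assumes rows: "\<forall>i. \<exists>N. \<forall>j<N. A i j = 0" and \<mu>: "\<mu> \<in> int_vecs l"
  shows "has_finite_sum (\<lambda>\<alpha>. const (\<Prod>i<l. A (- (\<mu> ! i)) (- (\<alpha> ! i))) * schur \<alpha>) (int_vecs l) (s_tilde A \<mu>)"
proof -
  obtain N where N: "\<And>i j. j < N i \<Longrightarrow> A i j = 0" using rows by metis
  define U where "U = Max (insert 0 ((\<lambda>k. - N (- k)) ` set \<mu>))"
  have l: "length \<mu> = l" using \<mu> by (simp add: int_vecs_def)
  have U: "A (- k) j = 0" if "k \<in> set \<mu>" "j < - U" for k j
  proof -
    have "- N (- k) \<le> U" unfolding U_def using that by (intro Max_ge) auto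
    then show ?thesis using that by (intro N) auto
  qed
  let ?X = "{\<alpha>. set \<alpha> \<subseteq> {- int l..U} \<and> length \<alpha> = l}"
  show ?thesis
  proof (rule has_finite_sumI[of ?X])
    show "finite ?X" by (rule finite_lists_length_eq) simp
    show "?X \<subseteq> int_vecs l" by (auto simp: int_vecs_def)
    show "(\<Sum>\<alpha>\<in>?X. const (\<Prod>i<l. A (- (\<mu> ! i)) (- (\<alpha> ! i))) * schur \<alpha>) = s_tilde A \<mu>"
      using s_tilde_eq_sum[OF rows, of \<mu> U "int l"] U l by simp
    fix \<alpha> assume "\<alpha> \<in> int_vecs l - ?X"
    then obtain i where i: "i < l" "length \<alpha> = l" "\<alpha> ! i \<notin> {- int l..U}"
      by (auto simp: int_vecs_def in_set_conv_nth subset_iff)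
    show "const (\<Prod>i<l. A (- (\<mu> ! i)) (- (\<alpha> ! i))) * schur \<alpha> = 0"
    proof (cases "\<alpha> ! i < - int l")
      case True
      then show ?thesis using i schur_eq_0_of_entry[of i \<alpha>] by simp
    next
      case False
      then have "A (- (\<mu> ! i)) (- (\<alpha> ! i)) = 0"
        using i l by (intro U) auto
      then have "(\<Prod>i<l. A (- (\<mu> ! i)) (- (\<alpha> ! i))) = 0" using i by (intro prod_zero) auto
      then show ?thesis by simp
    qed
  qed
qed

text \<open>Any finite \<open>K\<close> containing the support is allowed, so that one
  \<open>K\<close> can serve many pairs i, j.\<close>

lemma left_inverse_sum:
  assumes "left_inverse B A"
  shows "finite {k. B (- i) (- k) * A (- k) (- j) \<noteq> 0}"
    and "finite K \<Longrightarrow> {k. B (- i) (- k) * A (- k) (- j) \<noteq> 0} \<subseteq> K \<Longrightarrow>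
      (\<Sum>k\<in>K. B (- i) (- k) * A (- k) (- j)) = (if i = j then 1 else 0)"
proof -
  have sum: "has_finite_sum (\<lambda>k. B (- i) k * A k (- j)) UNIV (if i = j then 1 else 0)"
    using assms[unfolded left_inverse_def, rule_format, of "- i" "- j"] by (simp only: neg_equal_iff_equal)
  have "finite {k \<in> UNIV. B (- i) k * A k (- j) \<noteq> 0}"
    using sum unfolding has_finite_sum_def by blast
  from finite_vimageI[OF this, of uminus]
  show "finite {k. B (- i) (- k) * A (- k) (- j) \<noteq> 0}" by (simp add: vimage_def)
  assume K: "finite K" "{k. B (- i) (- k) * A (- k) (- j) \<noteq> 0} \<subseteq> K"
  have "B (- i) k * A k (- j) = 0" if "k \<notin> uminus ` K" for k
  proof -
    have "- k \<notin> K" using that by (metis image_eqI minus_minus)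
    then have "- k \<notin> {k. B (- i) (- k) * A (- k) (- j) \<noteq> 0}" using K(2) by blast
    then show ?thesis by simp
  qed
  then have "(\<Sum>k\<in>uminus ` K. B (- i) k * A k (- j)) = (if i = j then 1 else 0)"
    by (intro has_finite_sumD[OF sum]) (use K in auto)
  then show "(\<Sum>k\<in>K. B (- i) (- k) * A (- k) (- j)) = (if i = j then 1 else 0)"
    by (simp add: sum.reindex)
qed

lemma sum_lists_prod:
  assumes "finite K"
  shows "(\<Sum>\<mu> | set \<mu> \<subseteq> K \<and> length \<mu> = l. \<Prod>i<l. X i (\<mu> ! i)) = (\<Prod>i<l. \<Sum>k\<in>K. X i k :: 'a::comm_semiring_1)"
proof (induction l arbitrary: X)
  case 0
  have "{\<mu>. set \<mu> \<subseteq> K \<and> length \<mu> = 0} = {[]}" by auto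
  then show ?case by simp
next
  case (Suc l)
  have "(\<Sum>\<mu> | set \<mu> \<subseteq> K \<and> length \<mu> = Suc l. \<Prod>i<Suc l. X i (\<mu> ! i)) =
    (\<Sum>(\<mu>, k)\<in>{\<mu>. set \<mu> \<subseteq> K \<and> length \<mu> = l} \<times> K. X 0 k * (\<Prod>i<l. X (Suc i) (\<mu> ! i)))"
    unfolding lists_length_Suc_eq
    by (subst sum.reindex) (auto intro!: sum.cong inj_onI simp: prod.lessThan_Suc_shift simp del: prod.lessThan_Suc)
  also have "\<dots> = (\<Sum>\<mu> | set \<mu> \<subseteq> K \<and> length \<mu> = l. \<Prod>i<l. X (Suc i) (\<mu> ! i)) * (\<Sum>k\<in>K. X 0 k)"
    by (subst sum_product) (simp add: mult.commute flip: sum.cartesian_product)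
  finally show ?case by (simp add: Suc[of "\<lambda>i. X (Suc i)"] prod.lessThan_Suc_shift mult.commute del: prod.lessThan_Suc)
qed

text \<open>Homogeneity fixes the sum of the entries, and each is at least -l, so each is at most
  wt(m) + (l - 1) l. Only finitely many vectors contribute to one coefficient.\<close>

lemma lookup_schur_nonzero:
  assumes "lookup (schur \<beta>) m \<noteq> 0" "length \<beta> = l"
  shows "set \<beta> \<subseteq> {- int l..int (wt m) + int l * int l}"
proof
  have sum: "sum_list \<beta> = int (wt m)"
    using homog_schur[of \<beta>] assms(1) by (simp add: homog_def in_keys_iff)
  have lower: "- int l \<le> \<beta> ! i" if "i < l" for i
    using that assms schur_eq_0_of_entry[of i \<beta>] by (force simp: not_le)
  fix b assume "b \<in> set \<beta>"
  then obtain i where i: "i < l" "b = \<beta> ! i" using assms by (auto simp: in_set_conv_nth)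
  have "(\<Sum>j\<in>{0..<l} - {i}. - int l) \<le> (\<Sum>j\<in>{0..<l} - {i}. \<beta> ! j)"
    by (rule sum_mono) (use lower in auto)
  then have "- (int (l - 1) * int l) \<le> sum_list \<beta> - b"
    using i assms by (simp add: sum_list_sum_nth sum.remove[of _ i])
  moreover have "int (l - 1) * int l \<le> int l * int l"
    by (intro mult_right_mono) auto
  ultimately have "b \<le> int (wt m) + int l * int l" using sum by linarith
  then show "b \<in> {- int l..int (wt m) + int l * int l}"
    using lower[of i] i by simp
qed

text \<open>For a fixed monomial m the finite set \<open>F\<close> of relevant Schur functions does
  not depend on \<mu>. The sum over \<mu> can thus be taken inside, where it factors into sums over
  k of products of entries of B and A, which are Kronecker deltas.\<close>

lemma schur_has_formal_sum:
  assumes rows: "\<forall>i. \<exists>N. \<forall>j<N. A i j = 0" and inv: "left_inverse B A" and \<alpha>: "\<alpha> \<in> int_vecs l"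
  shows "has_formal_sum (\<lambda>\<mu>. const (\<Prod>i<l. B (- (\<alpha> ! i)) (- (\<mu> ! i))) * s_tilde A \<mu>) (int_vecs l) (schur \<alpha>)"
  unfolding has_formal_sum_def
proof
  fix m
  define F where "F = {\<beta>. set \<beta> \<subseteq> {- int l..int (wt m) + int l * int l} \<and> length \<beta> = l}"
  have F: "finite F" "F \<subseteq> int_vecs l"
    by (auto simp: F_def int_vecs_def intro: finite_lists_length_eq)
  have F0: "lookup (schur \<beta>) m = 0" if "\<beta> \<in> int_vecs l - F" for \<beta>
    using that lookup_schur_nonzero[of \<beta> m l] by (auto simp: F_def int_vecs_def)
  have lookup: "lookup (s_tilde A \<mu>) m =
    (\<Sum>\<beta>\<in>F. (\<Prod>i<l. A (- (\<mu> ! i)) (- (\<beta> ! i))) * lookup (schur \<beta>) m)" if \<mu>: "\<mu> \<in> int_vecs l" for \<mu>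
  proof -
    let ?a = "\<lambda>\<alpha>. const (\<Prod>i<l. A (- (\<mu> ! i)) (- (\<alpha> ! i))) * schur \<alpha>"
    let ?S = "{\<alpha> \<in> int_vecs l. ?a \<alpha> \<noteq> 0}"
    have S: "finite ?S" "s_tilde A \<mu> = sum ?a ?S"
      using s_tilde_has_finite_sum[OF rows \<mu>] by (simp_all add: has_finite_sum_def)
    have "lookup (s_tilde A \<mu>) m = (\<Sum>\<beta>\<in>?S. lookup (?a \<beta>) m)"
      by (simp add: S(2) lookup_sum)
    also have "\<dots> = (\<Sum>\<beta>\<in>?S \<union> F. lookup (?a \<beta>) m)"
    proof (intro sum.mono_neutral_left ballI)
      fix \<beta> assume "\<beta> \<in> ?S \<union> F - ?S"
      then have "?a \<beta> = 0" using F(2) by blast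
      then show "lookup (?a \<beta>) m = 0" by (simp only: lookup_zero)
    qed (use S(1) F in auto)
    also have "\<dots> = (\<Sum>\<beta>\<in>F. lookup (?a \<beta>) m)"
      using S(1) F F0 by (intro sum.mono_neutral_right) (auto simp: lookup_const_mult)
    finally show ?thesis by (simp add: lookup_const_mult)
  qed
  \<comment> \<open>If some entry of \<mu> lies outside \<open>K\<close>, a factor vanishes for
    every \<beta> in \<open>F\<close> simultaneously.\<close>
  define K where "K = (\<Union>\<beta>\<in>F. \<Union>i<l. {k. B (- (\<alpha> ! i)) (- k) * A (- k) (- (\<beta> ! i)) \<noteq> 0})"
  have K: "finite K" using F left_inverse_sum(1)[OF inv] by (simp add: K_def)
  let ?G = "{\<mu>. set \<mu> \<subseteq> K \<and> length \<mu> = l}"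
  let ?X = "\<lambda>\<beta> i k. B (- (\<alpha> ! i)) (- k) * A (- k) (- (\<beta> ! i))"
  have summand: "lookup (const (\<Prod>i<l. B (- (\<alpha> ! i)) (- (\<mu> ! i))) * s_tilde A \<mu>) m =
    (\<Sum>\<beta>\<in>F. lookup (schur \<beta>) m * (\<Prod>i<l. ?X \<beta> i (\<mu> ! i)))" if "\<mu> \<in> int_vecs l" for \<mu>
    by (simp only: lookup_const_mult lookup[OF that]) (simp add: sum_distrib_left prod.distrib mult_ac)
  show "has_finite_sum (\<lambda>\<mu>. lookup (const (\<Prod>i<l. B (- (\<alpha> ! i)) (- (\<mu> ! i))) * s_tilde A \<mu>) m)
     (int_vecs l) (lookup (schur \<alpha>) m)"
  proof (rule has_finite_sumI[of ?G])
    show "finite ?G" using K by (rule finite_lists_length_eq)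
    show "?G \<subseteq> int_vecs l" by (auto simp: int_vecs_def)
    fix \<mu> assume \<mu>: "\<mu> \<in> int_vecs l - ?G"
    then obtain i where "i < l" "\<mu> ! i \<notin> K"
      by (auto simp: int_vecs_def in_set_conv_nth subset_iff)
    then have zero: "(\<Prod>i<l. ?X \<beta> i (\<mu> ! i)) = 0" if "\<beta> \<in> F" for \<beta>
      using that by (intro prod_zero) (auto simp: K_def)
    have "(\<Sum>\<beta>\<in>F. lookup (schur \<beta>) m * (\<Prod>i<l. ?X \<beta> i (\<mu> ! i))) = 0"
      by (intro sum.neutral ballI) (simp only: zero mult_zero_right)
    then show "lookup (const (\<Prod>i<l. B (- (\<alpha> ! i)) (- (\<mu> ! i))) * s_tilde A \<mu>) m = 0"
      using \<mu> by (simp only: summand Diff_iff)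
  next
    have "(\<Sum>\<mu>\<in>?G. lookup (const (\<Prod>i<l. B (- (\<alpha> ! i)) (- (\<mu> ! i))) * s_tilde A \<mu>) m) =
      (\<Sum>\<mu>\<in>?G. \<Sum>\<beta>\<in>F. lookup (schur \<beta>) m * (\<Prod>i<l. ?X \<beta> i (\<mu> ! i)))"
      by (rule sum.cong) (auto simp: int_vecs_def intro!: summand)
    also have "\<dots> = (\<Sum>\<beta>\<in>F. lookup (schur \<beta>) m * (\<Prod>i<l. \<Sum>k\<in>K. ?X \<beta> i k))"
      by (subst sum.swap) (simp only: sum_distrib_left [symmetric] sum_lists_prod[OF K, where X = "?X \<beta>" for \<beta>])
    also have "\<dots> = (\<Sum>\<beta>\<in>F. if \<beta> = \<alpha> then lookup (schur \<alpha>) m else 0)"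
    proof (rule sum.cong)
      fix \<beta> assume \<beta>: "\<beta> \<in> F"
      have "(\<Prod>i<l. \<Sum>k\<in>K. ?X \<beta> i k) = (\<Prod>i<l. if \<alpha> ! i = \<beta> ! i then 1 else 0)"
        using \<beta> K by (intro prod.cong left_inverse_sum(2)[OF inv]) (auto simp: K_def)
      also have "\<dots> = (if \<beta> = \<alpha> then 1 else 0)"
      proof (cases "\<beta> = \<alpha>")
        case False
        have "length \<alpha> = l" "length \<beta> = l" using \<alpha> \<beta> by (auto simp: int_vecs_def F_def)
        then obtain i where "i < l" "\<alpha> ! i \<noteq> \<beta> ! i" using False nth_equalityI[of \<beta> \<alpha>] by metis
        then show ?thesis using False by (auto intro: prod_zero)
      qed simp
      finally show "lookup (schur \<beta>) m * (\<Prod>i<l. \<Sum>k\<in>K. ?X \<beta> i k) =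
        (if \<beta> = \<alpha> then lookup (schur \<alpha>) m else 0)" by simp
    qed simp
    also have "\<dots> = lookup (schur \<alpha>) m"
      using F F0[of \<alpha>] \<alpha> by auto
    finally show "(\<Sum>\<mu>\<in>?G. lookup (const (\<Prod>i<l. B (- (\<alpha> ! i)) (- (\<mu> ! i))) * s_tilde A \<mu>) m) =
      lookup (schur \<alpha>) m" .
  qed
qed

lemma s_tilde_eq_det:
  assumes rows: "\<forall>i. \<exists>N. \<forall>j<N. A i j = 0" and "\<mu> \<in> int_vecs l"
  shows "s_tilde A \<mu> = det (mat l l (\<lambda>(i, j). h_tilde A (\<mu> ! i) (int i - int j)))"
  using assms(2) unfolding s_tilde_eq_jt[OF rows] jt_def
  by (auto simp: jt_mat_def int_vecs_def h_row_def intro!: arg_cong[of _ _ det])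

text \<open>The monomial M occurs in h_(r-m) only if r - m is its weight. So its coefficient in
  \<open>h_tilde A k m\<close> involves a single entry of A, and the sum over k is one entry of the
  product of B and A.\<close>

lemma h_tilde_has_formal_sum:
  assumes rows: "\<forall>i. \<exists>N. \<forall>j<N. A i j = 0" and inv: "left_inverse B A"
  shows "has_formal_sum (\<lambda>k. const (g_coeff B k s) * h_tilde A k m) UNIV (hsym (s - m))"
  unfolding has_formal_sum_def
proof
  fix M
  define r where "r = m + int (wt M)"
  have 0: "lookup (hsym (j - m)) M = 0" if "j \<noteq> r" for j
  proof -
    have "M \<notin> keys (hsym (j - m))"
      using homog_hsym[of "j - m"] that unfolding homog_def r_def by force
    then show ?thesis by (simp add: in_keys_iff)
  qed
  have lookup: "lookup (h_tilde A k m) M = A (- k) (- r) * lookup (hsym (r - m)) M" for k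
  proof -
    obtain N where N: "\<And>j. j < N \<Longrightarrow> A (- k) j = 0" using rows by blast
    have "h_tilde A k m = h_row A k (- m)" by (simp add: h_row_def)
    \<comment> \<open>The maximum ensures that the interval contains r; r \<ge> m holds because
      weights are nonnegative.\<close>
    also have "\<dots> = (\<Sum>j\<in>{- (- m)..max r (- N)}. const (A (- k) (- j)) * hsym (j + - m))"
      using N by (intro h_row_eq_sum) auto
    finally have "lookup (h_tilde A k m) M =
      (\<Sum>j\<in>{m..max r (- N)}. A (- k) (- j) * lookup (hsym (j - m)) M)"
      by (simp add: lookup_sum lookup_const_mult)
    also have "\<dots> = (\<Sum>j\<in>{m..max r (- N)}. if j = r then A (- k) (- r) * lookup (hsym (r - m)) M else 0)"
      using 0 by (intro sum.cong) auto
    also have "\<dots> = A (- k) (- r) * lookup (hsym (r - m)) M" by (simp add: r_def)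
    finally show ?thesis .
  qed
  let ?K = "{k. B (- s) (- k) * A (- k) (- r) \<noteq> 0}"
  show "has_finite_sum (\<lambda>k. lookup (const (g_coeff B k s) * h_tilde A k m) M) UNIV (lookup (hsym (s - m)) M)"
  proof (rule has_finite_sumI[of ?K])
    show "finite ?K" by (rule left_inverse_sum(1)[OF inv])
    have "(\<Sum>k\<in>?K. lookup (const (g_coeff B k s) * h_tilde A k m) M) =
      (\<Sum>k\<in>?K. B (- s) (- k) * A (- k) (- r)) * lookup (hsym (r - m)) M"
      by (simp add: lookup_const_mult lookup g_coeff_def sum_distrib_right mult.assoc)
    also have "\<dots> = lookup (hsym (s - m)) M"
      using 0[of s] by (subst left_inverse_sum(2)[OF inv \<open>finite ?K\<close>]) auto
    finally show "(\<Sum>k\<in>?K. lookup (const (g_coeff B k s) * h_tilde A k m) M) = lookup (hsym (s - m)) M" .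
  qed (auto simp: lookup_const_mult lookup g_coeff_def)
qed

section \<open>Symmetry and stability\<close>

lemma symmetric_poly_in_vars: "symmetric_poly n (in_vars n f)"
  unfolding symmetric_poly_def
proof (intro conjI allI impI)
  show "\<forall>m\<in>keys (in_vars n f). keys m \<subseteq> {..<n}"
    using vars_below_in_vars[of n f] by (simp add: vars_below_def)
  fix \<pi> assume \<pi>: "\<pi> permutes {..<n}"
  have "(\<Sum>i<n. xvar (\<pi> i) ^ Suc k) = (\<Sum>i<n. xvar i ^ Suc k)" for k
    using sum.permute[OF \<pi>, of "\<lambda>i. xvar i ^ Suc k"] by (simp add: o_def)
  then show "subst (\<lambda>i. xvar (\<pi> i)) (in_vars n f) = in_vars n f"
    unfolding in_vars_def subst_subst
    by (simp only: subst.hom_sum subst.hom_power subst_xvar)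
qed

lemma subst_in_vars_Suc: "subst (xvar(n := 0)) (in_vars (Suc n) f) = in_vars n f"
  unfolding in_vars_def subst_subst
  by (simp add: subst.hom_sum subst.hom_power subst.hom_mult subst.hom_add)

section \<open>The bialternant formula\<close>

text \<open>\<open>fold_hsym n p a\<close> is the coefficient of \<open>t\<^sup>a\<close> in \<open>p(t) H(t)\<close>, with \<open>H(t)\<close> in \<open>n\<close> variables.\<close>

definition fold_hsym :: "nat \<Rightarrow> mpoly poly \<Rightarrow> int \<Rightarrow> mpoly" where
  "fold_hsym n p a = (\<Sum>k\<le>degree p. coeff p k * in_vars n (hsym (a - int k)))"

lemma fold_hsym_eq:
  "degree p \<le> B \<Longrightarrow> fold_hsym n p a = (\<Sum>k\<le>B. coeff p k * in_vars n (hsym (a - int k)))"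
  unfolding fold_hsym_def by (rule sum.mono_neutral_left) (auto simp: coeff_eq_0)

lemma fold_hsym_mult_linear:
  "fold_hsym n (p * [:1, - x:]) a = fold_hsym n p a - x * fold_hsym n p (a - 1)"
proof -
  let ?B = "degree p"
  have deg: "degree (p * [:1, - x:]) \<le> Suc ?B"
    using degree_mult_le[of p "[:1, - x:]"] by (auto split: if_splits)
  have coeff: "coeff (p * [:1, - x:]) k = coeff p k - (case k of 0 \<Rightarrow> 0 | Suc i \<Rightarrow> x * coeff p i)" for k
    by (simp add: coeff_pCons split: nat.split)
  have "fold_hsym n (p * [:1, - x:]) a =
    (\<Sum>k\<le>Suc ?B. coeff p k * in_vars n (hsym (a - int k))) -
    (\<Sum>k\<le>Suc ?B. (case k of 0 \<Rightarrow> 0 | Suc i \<Rightarrow> x * coeff p i) * in_vars n (hsym (a - int k)))"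
    unfolding fold_hsym_eq[OF deg] coeff by (simp only: left_diff_distrib sum_subtractf)
  also have "(\<Sum>k\<le>Suc ?B. coeff p k * in_vars n (hsym (a - int k))) = fold_hsym n p a"
    by (rule fold_hsym_eq[symmetric]) simp
  also have "(\<Sum>k\<le>Suc ?B. (case k of 0 \<Rightarrow> 0 | Suc i \<Rightarrow> x * coeff p i) * in_vars n (hsym (a - int k))) =
    x * fold_hsym n p (a - 1)"
    by (subst sum.atMost_Suc_shift) (simp add: fold_hsym_def sum_distrib_left mult.assoc diff_diff_eq)
  finally show ?thesis .
qed

lemma coeff_prod_linear:
  "coeff (\<Prod>r<n. [:1, - xvar r:]) k = const ((-1) ^ k) * elementary_poly k n"
proof (induction n arbitrary: k)
  case 0
  show ?case by (cases k) (simp_all add: elementary_poly_0 elementary_poly_Suc_0 coeff_pCons one_pCons)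
next
  case (Suc n)
  show ?case
  proof (cases k)
    case 0
    then show ?thesis using Suc[of 0] by (simp add: elementary_poly_0 coeff_mult)
  next
    case (Suc i)
    have "coeff (p * [:1, - x:]) (Suc i) = coeff p (Suc i) - x * coeff p i" for p and x :: mpoly
      by simp
    then show ?thesis
      unfolding \<open>k = Suc i\<close> prod.lessThan_Suc
      by (simp only: Suc.IH elementary_poly_Suc_Suc) (simp add: const.hom_uminus algebra_simps)
  qed
qed

text \<open>This is E(-t) H(t) = 1 in n variables.\<close>

lemma fold_hsym_prod_linear:
  "fold_hsym n (\<Prod>r<n. [:1, - xvar r:]) a = (if a = 0 then 1 else 0)"
proof -
  let ?B = "max (degree (\<Prod>r<n. [:1, - xvar r:])) (nat a)"
  have "fold_hsym n (\<Prod>r<n. [:1, - xvar r:]) a =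
    in_vars n (\<Sum>b\<le>?B. (-1) ^ b * esym b * hsym (a - int b))"
    by (subst fold_hsym_eq[of _ ?B])
      (simp_all add: coeff_prod_linear in_vars.hom_sum in_vars.hom_mult in_vars.hom_power in_vars.hom_uminus
        esym_eq in_vars_qsym_minus_1 const.hom_power const.hom_uminus)
  also have "(\<Sum>b\<le>?B. (-1) ^ b * esym b * hsym (a - int b)) = (if a = 0 then 1 else 0)"
    by (rule sum_alternating_hsym) auto
  finally show ?thesis by simp
qed

text \<open>Restoring the factor 1 - x_i t must give the series 1, so the coefficients satisfy c_a =
  x_i c_(a-1) + [a = 0], the recursion of a geometric series.\<close>

lemma fold_hsym_prod_linear_remove:
  assumes "i < n"
  shows "fold_hsym n (\<Prod>r\<in>{..<n} - {i}. [:1, - xvar r:]) a = (if a < 0 then 0 else xvar i ^ nat a)"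
proof -
  let ?p = "\<Prod>r\<in>{..<n} - {i}. [:1, - xvar r:]"
  have "(\<Prod>r<n. [:1, - xvar r:]) = ?p * [:1, - xvar i:]"
    using assms by (subst prod.remove[of _ i]) (auto simp: mult.commute simp del: mult_pCons_left mult_pCons_right)
  then have rec: "fold_hsym n ?p a = xvar i * fold_hsym n ?p (a - 1) + (if a = 0 then 1 else 0)" for a
    using fold_hsym_prod_linear[of n a] fold_hsym_mult_linear[of n ?p "xvar i" a] by (simp add: algebra_simps)
  have neg: "fold_hsym n ?p a = 0" if "a < 0" for a
    using that by (simp add: fold_hsym_def)
  have "fold_hsym n ?p (int m) = xvar i ^ m" for m
  proof (induction m)
    case 0
    show ?case using rec[of 0] neg[of "-1"] by simp
  next
    case (Suc m)
    then show ?case using rec[of "int (Suc m)"] by simp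
  qed
  from this[of "nat a"] show ?thesis using neg by auto
qed

text \<open>A nonzero entry together with the bound N makes the greatest element exist; for a zero
  row it is unspecified.\<close>

lemma first_pos_zero:
  assumes "A i j \<noteq> 0" "\<forall>j<N. A i j = 0" "r < first_pos A i"
  shows "A i r = 0"
proof -
  define k where "k = (LEAST n. A i (N + int n) \<noteq> 0)"
  have "N \<le> j" using assms(1,2) by (meson not_le)
  then have "A i (N + int (nat (j - N))) \<noteq> 0" using assms(1) by simp
  then have k: "A i (N + int k) \<noteq> 0" unfolding k_def by (rule LeastI)
  have zero: "A i r = 0" if "r < N + int k" for r
  proof (cases "r < N")
    case False
    then have "nat (r - N) < k" using that by simp
    then have "A i (N + int (nat (r - N))) = 0" unfolding k_def by (blast dest: not_less_Least)
    then show ?thesis using False by simp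
  qed (use assms(2) in blast)
  have "first_pos A i = N + int k"
    unfolding first_pos_def using k zero by (intro Greatest_equality) (blast, meson not_le)
  then show ?thesis using zero assms(3) by simp
qed

interpretation const_poly: map_poly_comm_ring_hom const ..

text \<open>The bound in \<open>f_poly\<close> depends on the row and is replaced by a common U. For
  k > 0 the missing term r = 0 agrees with \<open>neg\<close>.\<close>

lemma poly_at_f_poly:
  assumes N: "\<And>j. j < - U \<Longrightarrow> A (- k) j = 0" and U: "0 \<le> U" and k: "0 \<le> k"
    and neg: "\<forall>i<0. \<forall>j\<ge>0. A i j = 0" and zero: "\<forall>j. A 0 j = (if j = 0 then 1 else 0)"
  shows "poly_at (f_poly A k) x = (\<Sum>r\<in>{0..U}. const (A (- k) (- r)) * x ^ nat r)"
proof (cases "k = 0")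
  case True
  have "(\<Sum>r\<in>{0..U}. const (A (- k) (- r)) * x ^ nat r) = (\<Sum>r\<in>{0..U}. if r = 0 then 1 else 0)"
    using zero True by (intro sum.cong) auto
  then show ?thesis using True U by (simp add: f_poly_def poly_at_def)
next
  case False
  have row0: "A (- k) j = 0" if "j \<ge> 0" for j using neg k False that by simp
  have "poly_at (f_poly A k) x = (\<Sum>r\<in>{1..- first_pos A (- k)}. const (A (- k) (- r)) * x ^ nat r)"
    using False by (simp add: f_poly_def poly_at_def const_poly.hom_sum poly_sum poly_monom)
  also have "\<dots> = (\<Sum>r\<in>{0..U}. const (A (- k) (- r)) * x ^ nat r)"
  proof (rule sum.mono_neutral_cong)
    fix r assume r: "r \<in> {0..U} - {1..- first_pos A (- k)}"
    have "A (- k) (- r) = 0"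
    proof (cases "r = 0")
      case False
      then have "- r < first_pos A (- k)" using r by auto
      \<comment> \<open>By contradiction, the entry itself is the required nonzero witness, which
        also covers zero rows.\<close>
      then show ?thesis using first_pos_zero[of A "- k" "- r" "- U" "- r"] N by blast
    qed (simp add: row0)
    then show "const (A (- k) (- r)) * x ^ nat r = 0" by simp
  next
    fix r assume "r \<in> {1..- first_pos A (- k)} - {0..U}"
    then have "A (- k) (- r) = 0" by (intro N) auto
    then show "const (A (- k) (- r)) * x ^ nat r = 0" by simp
  qed simp_all
  finally show ?thesis .
qed

text \<open>Dividing the generating function \<open>\<Sum>k. h\<^sub>k t\<^sup>k\<close> in \<open>n\<close> variables by its factors \<open>1 / (1 - x\<^sub>r t)\<close>,
  \<open>r \<noteq> i\<close>, leaves \<open>\<Sum>k. x\<^sub>i\<^sup>k t\<^sup>k\<close>. So the matrix of coefficients of \<open>\<Prod>r\<noteq>i. (1 - x\<^sub>r t)\<close> maps the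
  Jacobi--Trudi matrix to the matrix of the bialternant formula.\<close>

lemma det_bialternant:
  assumes rows: "\<forall>i. \<exists>N. \<forall>j<N. A i j = 0"
    and neg: "\<forall>i<0. \<forall>j\<ge>0. A i j = 0" and zero: "\<forall>j. A 0 j = (if j = 0 then 1 else 0)"
  shows "\<exists>d. \<forall>\<nu>. length \<nu> = n \<longrightarrow> (\<forall>k\<in>set \<nu>. 0 \<le> k) \<longrightarrow>
    det (mat n n (\<lambda>(i, j). poly_at (f_poly A (\<nu> ! j)) (xvar i) * xvar i ^ (n - 1 - j))) =
      d * in_vars n (s_tilde A \<nu>)"
proof (intro exI allI impI)
  let ?p = "\<lambda>i. \<Prod>r\<in>{..<n} - {i}. [:1, - xvar r:]"
  \<comment> \<open>This matrix depends on n only, not on \<nu>; its determinant is the common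
    factor d.\<close>
  define C where "C = mat n n (\<lambda>(i, k). coeff (?p i) (n - 1 - k))"
  fix \<nu> :: "int list" assume \<nu>: "length \<nu> = n" "\<forall>k\<in>set \<nu>. 0 \<le> k"
  obtain N where N: "\<And>i j. j < N i \<Longrightarrow> A i j = 0" using rows by metis
  define U where "U = Max (insert 0 ((\<lambda>k. - N (- k)) ` set \<nu>))"
  have U0: "0 \<le> U" unfolding U_def by (intro Max_ge) auto
  have U: "A (- k) j = 0" if "k \<in> set \<nu>" "j < - U" for k j
  proof -
    have "- N (- k) \<le> U" unfolding U_def using that by (intro Max_ge) auto
    then show ?thesis using that by (intro N) auto
  qed
  define W where "W = mat n n (\<lambda>(k, j). in_vars n (h_row A (\<nu> ! j) (int k - int j)))"
  let ?F = "mat n n (\<lambda>(i, j). poly_at (f_poly A (\<nu> ! j)) (xvar i) * xvar i ^ (n - 1 - j))"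
  have C: "C \<in> carrier_mat n n" and W: "W \<in> carrier_mat n n" by (simp_all add: C_def W_def)
  have "C * W = ?F"
  proof (rule eq_matI)
    fix i j assume "i < dim_row ?F" "j < dim_col ?F"
    then have ij: "i < n" "j < n" by auto
    let ?k = "\<nu> ! j"
    have mem: "?k \<in> set \<nu>" using ij \<nu> by simp
    then have k: "0 \<le> ?k" using \<nu> by blast
    have deg: "degree (?p i) \<le> n - 1"
    proof -
      have "degree (?p i) \<le> (\<Sum>r\<in>{..<n} - {i}. degree [:1, - xvar r:])"
        using degree_prod_sum_le[of "{..<n} - {i}" "\<lambda>r. [:1, - xvar r:]"] by (simp add: o_def)
      also have "\<dots> \<le> (\<Sum>r\<in>{..<n} - {i}. 1)" by (rule sum_mono) auto
      finally show ?thesis using ij by simp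
    qed
    have "(C * W) $$ (i, j) = (\<Sum>k<n. coeff (?p i) (n - 1 - k) * in_vars n (h_row A ?k (int k - int j)))"
      using ij by (simp add: C_def W_def scalar_prod_def lessThan_atLeast0)
    also have "\<dots> = (\<Sum>k<n. coeff (?p i) k * in_vars n (h_row A ?k (int (n - 1 - k) - int j)))"
      by (subst sum.nat_diff_reindex[symmetric]) simp
    also have "\<dots> = (\<Sum>k<n. \<Sum>r\<in>{- int n..U}. const (A (- ?k) (- r)) *
        (coeff (?p i) k * in_vars n (hsym (r + int (n - 1) - int j - int k))))"
    proof (rule sum.cong)
      fix k assume k: "k \<in> {..<n}"
      have "h_row A ?k (int (n - 1 - k) - int j) =
        (\<Sum>r\<in>{- int n..U}. const (A (- ?k) (- r)) * hsym (r + (int (n - 1 - k) - int j)))"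
        using ij U[OF mem] by (intro h_row_eq_sum) auto
      moreover have "r + (int (n - 1 - k) - int j) = r + int (n - 1) - int j - int k" for r
        using k by (simp add: of_nat_diff)
      ultimately show "coeff (?p i) k * in_vars n (h_row A ?k (int (n - 1 - k) - int j)) =
        (\<Sum>r\<in>{- int n..U}. const (A (- ?k) (- r)) *
          (coeff (?p i) k * in_vars n (hsym (r + int (n - 1) - int j - int k))))"
        by (simp only: in_vars.hom_sum in_vars.hom_mult in_vars_const sum_distrib_left mult.left_commute)
    qed simp
    also have "\<dots> = (\<Sum>r\<in>{- int n..U}. const (A (- ?k) (- r)) * fold_hsym n (?p i) (r + int (n - 1) - int j))"
    proof -
      have "{..<n} = {..n - 1}" using ij by auto
      then show ?thesis unfolding fold_hsym_eq[OF deg] by (subst sum.swap) (simp add: sum_distrib_left)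
    qed
    also have "\<dots> = (\<Sum>r\<in>{0..U}. const (A (- ?k) (- r)) * xvar i ^ nat r * xvar i ^ (n - 1 - j))"
    proof (rule sum.mono_neutral_cong_right)
      \<comment> \<open>The assumptions on A remove negative r, for which x_i^(n-1-j) could not be
        split off.\<close>
      show "\<forall>r\<in>{- int n..U} - {0..U}.
        const (A (- ?k) (- r)) * fold_hsym n (?p i) (r + int (n - 1) - int j) = 0"
      proof
        fix r assume "r \<in> {- int n..U} - {0..U}"
        then have "A (- ?k) (- r) = 0" using neg zero k by (cases "?k = 0") auto
        then show "const (A (- ?k) (- r)) * fold_hsym n (?p i) (r + int (n - 1) - int j) = 0" by simp
      qed
      fix r assume r: "r \<in> {0..U}"
      have "r + int (n - 1) - int j = int (nat r + (n - 1 - j))" using r ij by auto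
      then show "const (A (- ?k) (- r)) * fold_hsym n (?p i) (r + int (n - 1) - int j) =
        const (A (- ?k) (- r)) * xvar i ^ nat r * xvar i ^ (n - 1 - j)"
        by (simp only: fold_hsym_prod_linear_remove[OF ij(1)] nat_int power_add mult.assoc) simp
    qed auto
    also have "\<dots> = ?F $$ (i, j)"
      using ij U[OF mem] U0 k neg zero by (simp add: poly_at_f_poly[where U = U] sum_distrib_right)
    finally show "(C * W) $$ (i, j) = ?F $$ (i, j)" .
  qed (simp_all add: C_def W_def)
  then have "det ?F = det C * det W" using det_mult[OF C W] by simp
  also have "det W = det (transpose_mat W)" by (rule det_transpose[OF W, symmetric])
  also have "transpose_mat W = map_mat (in_vars n) (jt_mat (map (h_row A) \<nu>))"
    using \<nu> by (intro eq_matI) (auto simp: W_def jt_mat_def)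
  also have "det \<dots> = in_vars n (s_tilde A \<nu>)"
    by (simp add: s_tilde_eq_jt[OF rows] jt_def)
  finally show "det ?F = det C * in_vars n (s_tilde A \<nu>)" .
qed

text \<open>After setting x_i = i, a kernel vector would be the coefficient list of a nonzero
  polynomial of degree below n with the n roots 0, ..., n - 1.\<close>

lemma det_vandermonde_nonzero: "det (mat n n (\<lambda>(i, j). xvar i ^ (n - 1 - j))) \<noteq> 0"
proof
  let ?V = "mat n n (\<lambda>(i, j). xvar i ^ (n - 1 - j))"
  assume V: "det ?V = 0"
  have id: "coeff_hom (\<lambda>c::complex. c)" by unfold_locales auto
  define ev where "ev = peval (\<lambda>c::complex. c) of_nat"
  interpret ev: comm_ring_hom ev unfolding ev_def by (rule coeff_hom.comm_ring_hom_peval[OF id])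
  let ?M = "map_mat ev ?V"
  have M: "?M \<in> carrier_mat n n" by simp
  have "det ?M = 0" by (simp only: ev.hom_det V ev.hom_zero)
  then obtain v where v: "v \<in> carrier_vec n" "v \<noteq> 0\<^sub>v n" "?M *\<^sub>v v = 0\<^sub>v n"
    unfolding det_0_iff_vec_prod_zero_field[OF M] by blast
  define q where "q = (\<Sum>j<n. monom (v $ j) (n - 1 - j))"
  have coeff: "coeff q (n - 1 - j) = v $ j" if "j < n" for j
  proof -
    have "coeff q (n - 1 - j) = (\<Sum>i<n. if i = j then v $ j else 0)"
      unfolding q_def coeff_sum coeff_monom using that by (intro sum.cong) auto
    then show ?thesis using that by simp
  qed
  have root: "poly q (of_nat i) = 0" if "i < n" for i
  proof -
    have "ev (xvar i) = of_nat i" for i by (simp add: ev_def coeff_hom.peval_xvar[OF id])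
    then have "(?M *\<^sub>v v) $ i = poly q (of_nat i)"
      using that v(1) by (simp add: scalar_prod_def q_def poly_sum poly_monom ev.hom_power lessThan_atLeast0 mult.commute)
    moreover have "(?M *\<^sub>v v) $ i = 0" unfolding v(3) using that by simp
    ultimately show ?thesis by (simp only:)
  qed
  have "q = 0"
  proof (rule ccontr)
    assume q: "q \<noteq> 0"
    have "n = card (of_nat ` {..<n} :: complex set)" by (simp add: card_image inj_on_def)
    also have "\<dots> \<le> card {x. poly q x = 0}"
      using root q by (intro card_mono poly_roots_finite) auto
    also have "\<dots> \<le> degree q" by (rule card_poly_roots_bound[OF q])
    finally have "n \<le> degree q" .
    moreover have "degree q \<le> n - 1"
      unfolding q_def by (intro degree_sum_le) (auto intro: order.trans[OF degree_monom_le])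
    \<comment> \<open>Truncated subtraction leaves n = 0 open, where q is an empty sum.\<close>
    ultimately have "n = 0" by simp
    then show False using q by (simp add: q_def)
  qed
  then have "v = 0\<^sub>v n" using coeff v(1) by (intro eq_vecI) auto
  then show False using v(2) by simp
qed

text \<open>Row 0 of A is a unit vector, so the operator for the entry 0 fixes 1; trailing entries
  are the first to act on 1.\<close>

lemma s_tilde_append_zeros:
  assumes rows: "\<forall>i. \<exists>N. \<forall>j<N. A i j = 0" and zero: "\<forall>j. A 0 j = (if j = 0 then 1 else 0)"
  shows "s_tilde A (\<mu> @ replicate d 0) = s_tilde A \<mu>"
proof -
  have "vertex (h_row A 0) 1 = h_row A 0 0"
    by (simp add: vertex_def)
  also have "h_row A 0 0 = (\<Sum>r\<in>{0..0}. const (A (- 0) (- r)) * hsym (r + 0))"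
    using zero h_row_eq_sum[of 0 A 0 0 0] by simp
  finally have "vertex (h_row A 0) 1 = 1" using zero by simp
  then have replicate: "s_tilde A (replicate d 0) = 1"
    by (induction d) (simp_all add: s_tilde_Cons[OF rows], simp add: s_tilde_def)
  show ?thesis
    by (induction \<mu>) (use replicate in \<open>simp_all add: s_tilde_Cons[OF rows]\<close>, simp add: s_tilde_def)
qed

text \<open>For \<nu> = 0 the numerator is the Vandermonde determinant and the deformed function is
  1, which identifies the factor d of \<open>det_bialternant\<close>.\<close>

lemma s_tilde_bialternant:
  assumes rows: "\<forall>i. \<exists>N. \<forall>j<N. A i j = 0"
    and neg: "\<forall>i<0. \<forall>j\<ge>0. A i j = 0" and zero: "\<forall>j. A 0 j = (if j = 0 then 1 else 0)"
    and \<mu>: "length \<mu> \<le> n" "\<forall>k\<in>set \<mu>. 0 < k"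
  defines "\<nu> \<equiv> \<mu> @ replicate (n - length \<mu>) 0"
  shows "Fract (in_vars n (s_tilde A \<mu>)) 1 =
    Fract (det (mat n n (\<lambda>(i, j). poly_at (f_poly A (\<nu> ! j)) (xvar i) * xvar i ^ (n - 1 - j)))) 1
    / Fract (det (mat n n (\<lambda>(i, j). xvar i ^ (n - 1 - j)))) 1"
proof -
  let ?V = "mat n n (\<lambda>(i, j). xvar i ^ (n - 1 - j))"
  obtain d where d: "\<And>\<nu>. length \<nu> = n \<Longrightarrow> \<forall>k\<in>set \<nu>. 0 \<le> k \<Longrightarrow>
    det (mat n n (\<lambda>(i, j). poly_at (f_poly A (\<nu> ! j)) (xvar i) * xvar i ^ (n - 1 - j))) =
      d * in_vars n (s_tilde A \<nu>)"
    using det_bialternant[OF rows neg zero, of n] by blast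
  have "?V = mat n n (\<lambda>(i, j). poly_at (f_poly A (replicate n 0 ! j)) (xvar i) * xvar i ^ (n - 1 - j))"
    by (intro eq_matI) (auto simp: f_poly_def poly_at_def)
  also have "det \<dots> = d * in_vars n (s_tilde A (replicate n 0))"
    by (rule d) auto
  also have "\<dots> = d"
    using s_tilde_append_zeros[OF rows zero, of "[]" n] by (simp add: s_tilde_def)
  finally have V: "det ?V = d" .
  have "det (mat n n (\<lambda>(i, j). poly_at (f_poly A (\<nu> ! j)) (xvar i) * xvar i ^ (n - 1 - j))) =
    d * in_vars n (s_tilde A \<nu>)"
    by (rule d) (use \<mu> in \<open>auto simp: \<nu>_def\<close>)
  moreover have "d \<noteq> 0" using V det_vandermonde_nonzero[of n] by simp
  ultimately show ?thesis
    unfolding V by (simp add: \<nu>_def s_tilde_append_zeros[OF rows zero] eq_fract)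
qed

lemma poly_f_poly_0: "0 < k \<Longrightarrow> poly (f_poly A k) 0 = 0"
  by (auto simp: f_poly_def poly_sum poly_monom intro!: sum.neutral)

theorem corollary5p1:
  fixes A :: "int \<Rightarrow> int \<Rightarrow> complex"
  assumes rows: "\<forall>i. \<exists>N. \<forall>j<N. A i j = 0"
  shows
    \<comment> \<open>(a)\<close>
    "(\<forall>l. \<forall>\<mu> \<in> int_vecs l.
        has_finite_sum (\<lambda>\<alpha>. const (\<Prod>i<l. A (- (\<mu> ! i)) (- (\<alpha> ! i))) * schur \<alpha>)
          (int_vecs l) (s_tilde A \<mu>)) \<and>
     (\<forall>B. left_inverse B A \<longrightarrow>
        (\<forall>l. \<forall>\<alpha> \<in> int_vecs l.
          has_formal_sum (\<lambda>\<mu>. const (\<Prod>i<l. B (- (\<alpha> ! i)) (- (\<mu> ! i))) * s_tilde A \<mu>)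
            (int_vecs l) (schur \<alpha>))) \<and>
     \<comment> \<open>(b)\<close>
     (\<forall>l. \<forall>\<mu> \<in> int_vecs l.
        s_tilde A \<mu> = det (mat l l (\<lambda>(i, j). h_tilde A (\<mu> ! i) (int i - int j)))) \<and>
     (\<forall>B. left_inverse B A \<longrightarrow>
        (\<forall>m s. has_formal_sum (\<lambda>k. const (g_coeff B k s) * h_tilde A k m) UNIV (hsym (s - m)))) \<and>
     \<comment> \<open>(c)\<close>
     (\<forall>\<mu> n. symmetric_poly n (in_vars n (s_tilde A \<mu>)) \<and>
        subst (xvar(n := 0)) (in_vars (Suc n) (s_tilde A \<mu>)) = in_vars n (s_tilde A \<mu>)) \<and>
     \<comment> \<open>(d)\<close>
     (\<forall>B. left_inverse B A \<longrightarrow>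
        (\<forall>l. \<forall>\<alpha> \<in> int_vecs l.
          has_formal_sum (\<lambda>\<mu>. const (\<Prod>i<l. g_coeff B (\<mu> ! i) (\<alpha> ! i)) * s_tilde A \<mu>)
            (int_vecs l) (gen_fun \<alpha>))) \<and>
     \<comment> \<open>(e)\<close>
     ((\<forall>i<0. \<forall>j\<ge>0. A i j = 0) \<and> (\<forall>j. A 0 j = (if j = 0 then 1 else 0)) \<longrightarrow>
        (\<forall>k>0. poly (f_poly A k) 0 = 0) \<and>
        (\<forall>l n. \<forall>\<mu> \<in> int_vecs l. (\<forall>k \<in> set \<mu>. k > 0) \<longrightarrow> l \<le> n \<longrightarrow>
          (let \<nu> = \<mu> @ replicate (n - l) 0 in
            Fract (in_vars n (s_tilde A \<mu>)) 1 =
              Fract (det (mat n n (\<lambda>(i, j). poly_at (f_poly A (\<nu> ! j)) (xvar i) * xvar i ^ (n - 1 - j)))) 1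
              / Fract (det (mat n n (\<lambda>(i, j). xvar i ^ (n - 1 - j)))) 1)))"
proof (intro conjI allI ballI impI)
  fix l \<mu> assume "\<mu> \<in> int_vecs l"
  then show "has_finite_sum (\<lambda>\<alpha>. const (\<Prod>i<l. A (- (\<mu> ! i)) (- (\<alpha> ! i))) * schur \<alpha>)
          (int_vecs l) (s_tilde A \<mu>)"
    by (rule s_tilde_has_finite_sum[OF rows])
next
  fix B l \<alpha> assume "left_inverse B A" "\<alpha> \<in> int_vecs l"
  then show "has_formal_sum (\<lambda>\<mu>. const (\<Prod>i<l. B (- (\<alpha> ! i)) (- (\<mu> ! i))) * s_tilde A \<mu>)
            (int_vecs l) (schur \<alpha>)"
    by (rule schur_has_formal_sum[OF rows])
next
  fix l \<mu> assume "\<mu> \<in> int_vecs l"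
  then show "s_tilde A \<mu> = det (mat l l (\<lambda>(i, j). h_tilde A (\<mu> ! i) (int i - int j)))"
    by (rule s_tilde_eq_det[OF rows])
next
  fix B m s assume "left_inverse B A"
  then show "has_formal_sum (\<lambda>k. const (g_coeff B k s) * h_tilde A k m) UNIV (hsym (s - m))"
    by (rule h_tilde_has_formal_sum[OF rows])
next
  fix \<mu> n
  show "symmetric_poly n (in_vars n (s_tilde A \<mu>))"
    by (rule symmetric_poly_in_vars)
  show "subst (xvar(n := 0)) (in_vars (Suc n) (s_tilde A \<mu>)) = in_vars n (s_tilde A \<mu>)"
    by (rule subst_in_vars_Suc)
next
  fix B l \<alpha> assume "left_inverse B A" "\<alpha> \<in> int_vecs l"
  \<comment> \<open>Coefficientwise this is the inverse expansion of the Schur functions, as the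
    generating function has coefficients \<open>schur \<alpha>\<close>.\<close>
  then show "has_formal_sum (\<lambda>\<mu>. const (\<Prod>i<l. g_coeff B (\<mu> ! i) (\<alpha> ! i)) * s_tilde A \<mu>)
            (int_vecs l) (gen_fun \<alpha>)"
    unfolding gen_fun_eq_schur g_coeff_def by (rule schur_has_formal_sum[OF rows])
next
  fix k :: int assume "0 < k"
  then show "poly (f_poly A k) 0 = 0" by (rule poly_f_poly_0)
next
  fix l n :: nat and \<mu>
  assume "(\<forall>i<0. \<forall>j\<ge>0. A i j = 0) \<and> (\<forall>j. A 0 j = (if j = 0 then 1 else 0))"
    and "\<mu> \<in> int_vecs l" "\<forall>k\<in>set \<mu>. 0 < k" "l \<le> n"
  then show "let \<nu> = \<mu> @ replicate (n - l) 0 in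
            Fract (in_vars n (s_tilde A \<mu>)) 1 =
              Fract (det (mat n n (\<lambda>(i, j). poly_at (f_poly A (\<nu> ! j)) (xvar i) * xvar i ^ (n - 1 - j)))) 1
              / Fract (det (mat n n (\<lambda>(i, j). xvar i ^ (n - 1 - j)))) 1"
    using s_tilde_bialternant[OF rows, of \<mu> n] by (auto simp: Let_def int_vecs_def)
qed

end
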